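(* Let $n\geq k\geq 2$ be integers. Let $v_1,v_2,\dots,v_k$ be independent, uniform random elements of the sphere $S_{n-1}=\{x\in\mathbb{R}^n : \|x\|_2=1\}$, and let $M(k,n)$ be the $k\times k$ random matrix with entries $M(k,n)_{i,j}:=(v_i,v_j)$. Then the probability density function $f_{k,n}$ of $M(k,n)$ with respect to $\lambda_k$ is supported on the set $\mathcal{M}_k$ of positive semidefinite $k\times k$ matrices with $1$'s in the diagonal entries, and for $M\in\mathcal{M}_k$ it is given by $$f_{k,n}(M)=\det(M)^{(n-k-1)/2}\,\Gamma(n/2)^k\,\Gamma_k(n/2)^{-1}.$$
   Context: $(\cdot,\cdot)$ is the standard scalar product on $\mathbb{R}^n$. $\lambda_k$ denotes the Lebesgue measure on the space of real symmetric $k\times k$ matrices with $1$'s in the diagonal (identified with $\mathbb{R}^{k(k-1)/2}$ via the entries above the diagonal). $\Gamma_k$ is the multivariate Gamma function, $\Gamma_k(a)=\pi^{k(k-1)/4}\prod_{j=1}^{k}\Gamma\bigl(a-\tfrac{j-1}{2}\bigr)$. *)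

theory Defs
  imports "HOL-Probability.Probability"
begin

text \<open>
  The uniform distribution on the unit sphere, i.e. the normalised surface measure, as the
  radial projection of the uniform distribution on the unit ball: the measure of \<open>A\<close> is the
  normalised volume of the cone over \<open>A\<close>.  It is a measure on the sphere itself, so a random
  variable with values in it lies on the sphere surely.
\<close>

definition uniform_sphere :: "(real^'n) measure" where
  "uniform_sphere =
     restrict_space (distr (uniform_measure lborel (ball 0 1)) borel sgn) (sphere 0 1)"

lemma space_uniform_sphere [simp]: "space uniform_sphere = sphere 0 1"
  by (simp add: uniform_sphere_def space_restrict_space)

lemma sets_uniform_sphere [measurable_cong]:
  "sets uniform_sphere = sets (restrict_space borel (sphere 0 1))"
  by (simp add: uniform_sphere_def sets_restrict_space)

lemma emeasure_uniform_sphere: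
  fixes A :: "(real^'n) set"
  assumes "A \<in> sets uniform_sphere"
  shows "emeasure uniform_sphere A =
           emeasure lborel (ball 0 1 \<inter> sgn -` A) / emeasure lborel (ball (0::real^'n) 1)"
proof -
  have A: "A \<in> sets borel" "A \<subseteq> sphere 0 1"
    using assms by (auto simp: sets_uniform_sphere sets_restrict_space)
  have "emeasure uniform_sphere A =
          emeasure (distr (uniform_measure lborel (ball 0 1)) borel (sgn :: real^'n \<Rightarrow> _)) A"
    unfolding uniform_sphere_def using A by (subst emeasure_restrict_space) auto
  also have "\<dots> = emeasure (uniform_measure lborel (ball 0 1)) (sgn -` A)"
    using A by (subst emeasure_distr) auto
  also have "\<dots> = emeasure lborel (ball 0 1 \<inter> sgn -` A) / emeasure lborel (ball (0::real^'n) 1)"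
    using A measurable_sets_borel[OF borel_measurable_sgn A(1)]
    by (subst emeasure_uniform_measure) auto
  finally show ?thesis .
qed

lemma prob_space_uniform_sphere: "prob_space (uniform_sphere :: (real^'n) measure)"
proof
  have "emeasure lborel (ball 0 1 \<inter> sgn -` sphere (0::real^'n) 1)
          = emeasure lborel (ball (0::real^'n) 1 - {0})"
    by (rule arg_cong[of _ _ "emeasure lborel"]) (auto simp: norm_sgn)
  also have "\<dots> = emeasure lborel (ball (0::real^'n) 1)"
    by (rule emeasure_Diff_null_set) (auto simp: null_sets_def)
  finally have eq: "emeasure lborel (ball 0 1 \<inter> sgn -` sphere (0::real^'n) 1)
                      = emeasure lborel (ball (0::real^'n) 1)" .
  have "emeasure lborel (ball (0::real^'n) 1) \<noteq> 0"
    using emeasure_lborel_ball_finite[of "0::real^'n" 1]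
    by (simp add: emeasure_ball unit_ball_vol_pos less_imp_neq[symmetric])
  moreover have "emeasure lborel (ball (0::real^'n) 1) \<noteq> \<infinity>"
    using emeasure_lborel_ball_finite[of "0::real^'n" 1] by simp
  moreover have "sphere 0 1 \<in> sets (uniform_sphere :: (real^'n) measure)"
    by (metis sets.top space_uniform_sphere)
  ultimately show "emeasure (uniform_sphere :: (real^'n) measure) (space uniform_sphere) = 1"
    by (simp add: emeasure_uniform_sphere eq ennreal_divide_self top.not_eq_extremum)
qed

lemma distr_uniform_sphere_orthogonal:
  fixes f :: "real^'n::{finite,wellorder} \<Rightarrow> real^'n::_"
  assumes f: "orthogonal_transformation f"
  shows "distr uniform_sphere uniform_sphere f = uniform_sphere"
proof (rule measure_eqI)
  have nf: "norm (f x) = norm x" for x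
    using f by (simp add: orthogonal_transformation)
  have lf: "linear f"
    using f by (simp add: orthogonal_transformation)
  have sf: "sgn (f x) = f (sgn x)" for x
    by (simp add: sgn_div_norm nf linear_scale[OF lf])
  have fm [measurable]: "f \<in> borel_measurable borel"
    by (intro borel_measurable_continuous_onI linear_continuous_on)
       (use lf linear_conv_bounded_linear in blast)
  have m: "f \<in> measurable uniform_sphere uniform_sphere"
    unfolding measurable_cong_sets[OF sets_uniform_sphere sets_uniform_sphere]
    by (intro measurable_restrict_space3 fm) (auto simp: nf)
  fix A :: "(real^'n::_) set"
  assume "A \<in> sets (distr uniform_sphere uniform_sphere f)"
  then have A: "A \<in> sets uniform_sphere" by simp
  then have A': "A \<in> sets borel" "A \<subseteq> sphere 0 1"
    by (auto simp: sets_uniform_sphere sets_restrict_space)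
  define S where "S = ball 0 1 \<inter> sgn -` A"
  have S: "S \<in> sets borel"
    unfolding S_def using measurable_sets_borel[OF borel_measurable_sgn A'(1)] by auto
  have Sm: "S \<in> lmeasurable"
    by (rule bounded_set_imp_lmeasurable) (use S in \<open>auto simp: S_def intro: bounded_subset\<close>)
  have g: "orthogonal_transformation (inv f)"
    using f by (rule orthogonal_transformation_inv)
  have bf: "bij f"
    using f by (rule orthogonal_transformation_bij)
  have vS: "f -` S = inv f ` S"
    using bf by (simp add: bij_vimage_eq_inv_image)
  have fS: "f -` S \<in> sets borel"
    using measurable_sets_borel[OF fm S] by simp
  have fSm: "f -` S \<in> lmeasurable"
    unfolding vS by (rule measurable_orthogonal_image[OF g Sm])
  have "emeasure lborel (f -` S) = emeasure lebesgue (f -` S)"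
    using fS by simp
  also have "\<dots> = emeasure lebesgue S"
    using measure_orthogonal_image[OF g Sm] emeasure_eq_measure2[OF fSm] emeasure_eq_measure2[OF Sm]
    by (simp add: vS)
  also have "\<dots> = emeasure lborel S"
    using S by simp
  finally have eq: "emeasure lborel (f -` S) = emeasure lborel S" .
  have "emeasure (distr uniform_sphere uniform_sphere f) A
          = emeasure uniform_sphere (f -` A \<inter> sphere 0 1)"
    using A m by (subst emeasure_distr) auto
  also have "\<dots> = emeasure lborel (ball 0 1 \<inter> sgn -` (f -` A \<inter> sphere 0 1))
                    / emeasure lborel (ball (0::real^'n::_) 1)"
    using measurable_sets[OF m A] by (subst emeasure_uniform_sphere) auto
  also have "ball 0 1 \<inter> sgn -` (f -` A \<inter> sphere 0 1) = f -` S"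
    using A'(2) by (auto simp: S_def sf nf subset_iff)
  also have "emeasure lborel (f -` S) = emeasure lborel S" by (rule eq)
  also have "emeasure lborel S / emeasure lborel (ball (0::real^'n::_) 1) = emeasure uniform_sphere A"
    unfolding S_def using A by (simp add: emeasure_uniform_sphere)
  finally show "emeasure (distr uniform_sphere uniform_sphere f) A = emeasure uniform_sphere A" .
qed simp

definition sym_unit_diag :: "(real^'k^'k) set" where
  "sym_unit_diag = {A. transpose A = A \<and> (\<forall>i. A $ i $ i = 1)}"

definition above_diag :: "('k::linorder \<times> 'k) set" where
  "above_diag = {(i, j). i < j}"

definition matrix_of_above_diag :: "('k::{finite,linorder} \<times> 'k \<Rightarrow> real) \<Rightarrow> real^'k::_^'k::_" where
  "matrix_of_above_diag x =
     (\<chi> i j. if i = j then 1 else if i < j then x (i, j) else x (j, i))"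

definition lborel_sym_unit_diag :: "(real^'k::_^'k::{finite,linorder}) measure" where
  "lborel_sym_unit_diag =
     distr (\<Pi>\<^sub>M p\<in>above_diag. lborel) (restrict_space borel sym_unit_diag) matrix_of_above_diag"

lemma matrix_of_above_diag_measurable [measurable]:
  "matrix_of_above_diag \<in>
     measurable (\<Pi>\<^sub>M p\<in>above_diag. lborel)
       (restrict_space borel (sym_unit_diag :: (real^'k::_^'k::{finite,linorder}) set))"
proof (rule measurable_restrict_space2)
  show "matrix_of_above_diag \<in>
          space (\<Pi>\<^sub>M p\<in>above_diag. lborel) \<rightarrow> (sym_unit_diag :: (real^'k::_^'k::_) set)"
    by (auto simp: sym_unit_diag_def matrix_of_above_diag_def transpose_def vec_eq_iff)
  show "matrix_of_above_diag \<in> borel_measurable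
          (\<Pi>\<^sub>M p\<in>(above_diag :: ('k \<times> 'k) set). (lborel :: real measure))"
    (is "_ \<in> borel_measurable ?P")
  proof (subst borel_measurable_euclidean_space, safe)
    fix b :: "real^'k::_^'k::_"
    assume "b \<in> Basis"
    then obtain i j where b: "b = axis i (axis j 1)"
      by (auto simp: Basis_vec_def)
    have "(\<lambda>x. matrix_of_above_diag x $ i $ j) \<in> borel_measurable ?P"
    proof (cases i j rule: linorder_cases)
      case less
      then have "(i, j) \<in> above_diag" by (simp add: above_diag_def)
      from measurable_component_singleton[OF this, of "\<lambda>_. lborel :: real measure"] less
      show ?thesis by (simp add: matrix_of_above_diag_def less_imp_neq)
    next
      case greater
      then have "(j, i) \<in> above_diag" by (simp add: above_diag_def)
      from measurable_component_singleton[OF this, of "\<lambda>_. lborel :: real measure"] greater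
      show ?thesis by (simp add: matrix_of_above_diag_def less_imp_neq[symmetric] less_not_sym)
    qed (simp add: matrix_of_above_diag_def)
    then show "(\<lambda>x. matrix_of_above_diag x \<bullet> b) \<in> borel_measurable ?P"
      by (simp add: b inner_axis)
  qed
qed

definition pos_semidef :: "real^'k^'k \<Rightarrow> bool" where
  "pos_semidef A \<longleftrightarrow> transpose A = A \<and> (\<forall>x. 0 \<le> x \<bullet> (A *v x))"

definition psd_unit_diag :: "(real^'k^'k) set" where
  "psd_unit_diag = {A. pos_semidef A \<and> (\<forall>i. A $ i $ i = 1)}"

definition Gram_matrix :: "('k \<Rightarrow> real^'n) \<Rightarrow> real^'k^'k" where
  "Gram_matrix v = (\<chi> i j. v i \<bullet> v j)"

definition multivariate_Gamma :: "nat \<Rightarrow> real \<Rightarrow> real" where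
  "multivariate_Gamma k a =
     pi powr (real k * (real k - 1) / 4) * (\<Prod>j=1..k. Gamma (a - (real j - 1) / 2))"

end

theory Submission
  imports Defs
begin

text \<open>
  Suppose that \<open>m\<close> of the vectors are fixed, have unit length and are linearly independent, with Gram matrix
  \<open>M\<close>, and let \<open>w\<close> be a further uniform vector. Its inner products \<open>c\<close> with the fixed vectors have the
  density
  \<open>C (det M)\<^bsup>-1/2\<^esup> (1 - c \<bullet> M\<inverse> c)\<^bsup>(n-m)/2-1\<^esup>\<close> on \<open>\<real>\<^sup>m\<close>, restricted to \<open>c \<bullet> M\<inverse> c < 1\<close>, where
  \<open>C = \<Gamma>(n/2) / (\<pi>\<^bsup>m/2\<^esup> \<Gamma>((n-m)/2))\<close> (lemmas \<open>uniform_sphere_linear_functionals\<close> and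
  \<open>conditional_inner_products\<close>). By the Schur complement the Gram matrix of all \<open>m + 1\<close> vectors has
  the determinant \<open>det M (1 - c \<bullet> M\<inverse> c)\<close>, and for nonsingular \<open>M\<close> it is positive semidefinite exactly if
  \<open>c \<bullet> M\<inverse> c \<le> 1\<close>. Hence
  \<open>(det M)\<^bsup>(n-m-1)/2\<^esup>\<close> times the conditional density is \<open>C\<close> times the determinant of the larger matrix
  to the power \<open>(n-(m+1)-1)/2\<close> (lemma \<open>corr_density_border\<close>), and the constants \<open>C\<close> accumulate to
  \<open>\<Gamma>(n/2)\<^sup>k / \<Gamma>\<^sub>k(n/2)\<close>. Induction over the number of vectors gives the law of all inner products
  (lemma \<open>nn_integral_inner_pairs\<close>), and the theorem is its image under the map that fills a matrix
  with them.

  The conditional density comes from the representation \<open>w = x / |x|\<close> with \<open>x\<close> uniform in the ball. In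
  coordinates consisting of the inner products of \<open>x\<close> with the fixed vectors and of orthonormal
  coordinates on the orthogonal complement of their span (lemma \<open>Gram_coordinates\<close>) the Jacobian is
  \<open>(det M)\<^bsup>1/2\<^esup>\<close> and the squared norm is \<open>c \<bullet> M\<inverse> c\<close> plus a sum of \<open>n - m\<close> squares, whose law is
  known from the volume of balls. What remains is a translation and a scaling.
\<close>

section \<open>Determinants and bordered matrices\<close>

text \<open>
  The transport of a permutation along an injection, extended by the identity outside the range.
  The body is literally the map of \<open>bij_betw_permutations\<close>.
\<close>

definition insert_perm :: "('a \<Rightarrow> 'b) \<Rightarrow> ('a \<Rightarrow> 'a) \<Rightarrow> 'b \<Rightarrow> 'b" where
  "insert_perm e p = (\<lambda>x. if x \<in> range e then e (p (inv e x)) else x)"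

text \<open>
  A transposition goes to the transposition of the two images, so the claim follows by writing the
  permutation as a product of transpositions.
\<close>

lemma sign_insert_perm:
  fixes e :: "'a::finite \<Rightarrow> 'b::finite"
  assumes e: "inj e" and p: "p permutes UNIV"
  shows "sign (insert_perm e p) = sign p"
proof -
  have "finite (UNIV::'a set)" by simp
  from p this show ?thesis
  proof (induction rule: permutes_induct)
    case id
    have "insert_perm e id = id"
      using e by (auto simp: insert_perm_def fun_eq_iff)
    then show ?case by (simp only: sign_id)
  next
    case (swap a b p)
    have eq: "insert_perm e (Transposition.transpose a b \<circ> p) = Transposition.transpose (e a) (e b) \<circ> insert_perm e p"
      using e by (auto simp: insert_perm_def fun_eq_iff Transposition.transpose_def inj_eq)
    have "insert_perm e p permutes range e"
      unfolding insert_perm_def using e swap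
      by (intro permutes_bij_inv_into) (auto intro: inj_on_imp_bij_betw)
    then have "permutation (insert_perm e p)" by (meson finite permutation_permutes)
    moreover have "permutation p" using swap by (meson finite permutation_permutes)
    ultimately show ?case unfolding eq using swap e
      by (simp only: sign_compose permutation_swap_id sign_swap_id inj_eq if_False)
  qed
qed

text \<open>
  In the Leibniz formula for the big matrix a permutation contributes only if it fixes every index
  outside the range of \<open>e\<close>, and these permutations correspond to those of the small index set.
  The lemma moves determinants between the number of vectors and the dimension of the space.
\<close>

lemma det_inj_reindex:
  fixes e :: "'k::finite \<Rightarrow> 'n::finite" and G :: "real^'k^'k" and N :: "real^'n^'n"
  assumes e: "inj e"
    and G: "\<And>i j. N $ e i $ e j = G $ i $ j"
    and id: "\<And>i j. i \<notin> range e \<Longrightarrow> N $ i $ j = (if i = j then 1 else 0)"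
  shows "det N = det G"
proof -
  have bij: "bij_betw (insert_perm e) {p. p permutes UNIV} {p. p permutes range e}"
    unfolding insert_perm_def using e
    by (intro bij_betw_permutations) (auto intro: inj_on_imp_bij_betw)
  have "det N = (\<Sum>p | p permutes range e. of_int (sign p) * (\<Prod>i\<in>UNIV. N $ i $ p i))"
    unfolding det_def
  proof (rule sum.mono_neutral_right)
    show "{p. p permutes range e} \<subseteq> {p. p permutes (UNIV::'n set)}"
      by (auto intro: permutes_subset)
    show "\<forall>p\<in>{p. p permutes (UNIV::'n set)} - {p. p permutes range e}.
            of_int (sign p) * (\<Prod>i\<in>UNIV. N $ i $ p i) = 0"
    proof
      fix p assume p: "p \<in> {p. p permutes (UNIV::'n set)} - {p. p permutes range e}"
      then obtain i where "i \<notin> range e" "p i \<noteq> i"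
        using permutes_superset[of p UNIV "range e"] by blast
      then have "N $ i $ p i = 0" by (auto simp: id)
      then show "of_int (sign p) * (\<Prod>i\<in>UNIV. N $ i $ p i) = 0"
        by (auto intro: prod_zero)
    qed
  qed (simp add: finite_permutations)
  also have "\<dots> = (\<Sum>p | p permutes UNIV. of_int (sign (insert_perm e p)) * (\<Prod>i\<in>UNIV. N $ i $ insert_perm e p i))"
    by (rule sum.reindex_bij_betw[OF bij, symmetric])
  also have "\<dots> = (\<Sum>p | p permutes UNIV. of_int (sign p) * (\<Prod>i\<in>UNIV. G $ i $ p i))"
  proof (rule sum.cong[OF refl])
    fix p assume "p \<in> {p. p permutes (UNIV::'k set)}"
    then have p: "p permutes UNIV" by simp
    have "(\<Prod>i\<in>UNIV. N $ i $ insert_perm e p i) = (\<Prod>i\<in>range e. N $ i $ insert_perm e p i)"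
      by (rule prod.mono_neutral_right) (auto simp: id insert_perm_def)
    also have "\<dots> = (\<Prod>i\<in>UNIV. N $ e i $ insert_perm e p (e i))"
      using e by (simp add: prod.reindex)
    also have "\<dots> = (\<Prod>i\<in>UNIV. G $ i $ p i)"
      using e by (simp add: insert_perm_def G)
    finally show "of_int (sign (insert_perm e p)) * (\<Prod>i\<in>UNIV. N $ i $ insert_perm e p i) =
        of_int (sign p) * (\<Prod>i\<in>UNIV. G $ i $ p i)"
      using sign_insert_perm[OF e p] by simp
  qed
  finally show ?thesis by (simp add: det_def)
qed

text \<open>
  If the form vanishes at \<open>x\<close>, then moving from \<open>x\<close> in the direction \<open>A x\<close> changes it to first
  order by \<open>2 t |A x|\<^sup>2\<close>. A small negative \<open>t\<close> would make it negative unless \<open>A x = 0\<close>,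
  which invertibility excludes.
\<close>

lemma pos_semidef_det_nz_imp_pos_def:
  fixes A :: "real^'k^'k"
  assumes "pos_semidef A" "det A \<noteq> 0" "x \<noteq> 0"
  shows "0 < x \<bullet> (A *v x)"
proof (rule ccontr)
  assume "\<not> ?thesis"
  with assms have 0: "x \<bullet> (A *v x) = 0" by (auto simp: pos_semidef_def dest!: spec[of _ x])
  have sym: "transpose A = A" using assms by (simp add: pos_semidef_def)
  let ?y = "A *v x"
  have sym': "x \<bullet> (A *v ?y) = ?y \<bullet> ?y"
    by (metis dot_lmul_matrix sym transpose_matrix_vector)
  have *: "0 \<le> 2 * t * (?y \<bullet> ?y) + t^2 * (?y \<bullet> (A *v ?y))" for t
  proof -
    have "0 \<le> (x + t *\<^sub>R ?y) \<bullet> (A *v (x + t *\<^sub>R ?y))"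
      using assms by (simp add: pos_semidef_def)
    also have "\<dots> = 2 * t * (?y \<bullet> ?y) + t^2 * (?y \<bullet> (A *v ?y))"
      using 0 sym' by (simp add: matrix_vector_right_distrib matrix_vector_mult_scaleR
          inner_add_left inner_add_right power2_eq_square algebra_simps)
    finally show ?thesis .
  qed
  have "?y \<bullet> ?y = 0"
  proof (rule ccontr)
    assume "?y \<bullet> ?y \<noteq> 0"
    then have p: "?y \<bullet> ?y > 0" by (metis inner_gt_zero_iff inner_zero_left)
    define q r where "q = ?y \<bullet> (A *v ?y)" and "r = ?y \<bullet> ?y"
    have q: "q \<ge> 0" using assms unfolding q_def pos_semidef_def by blast
    define t where "t = - r / (q + 1)"
    have tq: "t * (q + 1) = - r" using q by (simp add: t_def)
    have "0 \<le> 2 * t * r + t^2 * q" using * by (simp add: q_def r_def)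
    also have "\<dots> \<le> 2 * t * r + t^2 * (q + 1)" by (simp add: algebra_simps)
    also have "t^2 * (q + 1) = - t * r"
      using tq by (simp add: power2_eq_square mult.assoc)
    also have "2 * t * r + - t * r = - (r^2 / (q + 1))"
      by (simp add: t_def power2_eq_square)
    also have "\<dots> < 0" using p q by (simp add: r_def)
    finally show False by simp
  qed
  then have "A *v x = 0" by simp
  moreover have "invertible A" using assms by (simp add: invertible_det_nz)
  ultimately show False using assms(3)
    by (metis invertible_def matrix_vector_mul_assoc matrix_vector_mul_lid matrix_vector_mult_0_right)
qed

text \<open>
  When \<open>M\<close> is a matrix on the indices other than \<open>b\<close>, completed by a unit row and column at \<open>b\<close>,
  this is the block matrix with blocks \<open>M\<close>, \<open>c\<close>, \<open>c\<^sup>T\<close>, \<open>1\<close>. Padding with the identity keeps all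
  matrices over one index type while the number of vectors grows.
\<close>

definition border :: "real^'k^'k \<Rightarrow> 'k \<Rightarrow> real^'k \<Rightarrow> real^'k^'k" where
  "border M b c = (\<chi> i j. M $ i $ j + (if j = b then c $ i else 0) + (if i = b then c $ j else 0))"

locale bordered =
  fixes M :: "real^'k^'k" and b :: 'k and c :: "real^'k"
  assumes sym: "transpose M = M" and Mb: "\<And>j. M $ b $ j = (if j = b then 1 else 0)"
    and cb: "c $ b = 0"
begin

lemma Mb': "M $ j $ b = (if j = b then 1 else 0)"
  using sym Mb by (metis transpose_def vec_lambda_beta)

lemma M_sym: "M $ i $ j = M $ j $ i"
  using sym by (metis transpose_def vec_lambda_beta)

lemma transpose_border: "transpose (border M b c) = border M b c"
  using M_sym by (auto simp: border_def vec_eq_iff transpose_def)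

lemma quad_border: "x \<bullet> (border M b c *v x) = x \<bullet> (M *v x) + 2 * (x $ b) * (c \<bullet> x)"
proof -
  have "(border M b c *v x) $ i = (M *v x + (x $ b) *\<^sub>R c + (c \<bullet> x) *\<^sub>R axis b 1) $ i" for i
  proof -
    have "(border M b c *v x) $ i = (\<Sum>j\<in>UNIV. M $ i $ j * x $ j + (if b = j then c $ i * x $ j else 0)
        + (if i = b then c $ j * x $ j else 0))"
      unfolding matrix_vector_mult_def vec_lambda_beta
      by (rule sum.cong) (auto simp: border_def distrib_right)
    then show ?thesis
      by (simp add: sum.distrib matrix_vector_mult_def inner_vec_def axis_def)
  qed
  then have "border M b c *v x = M *v x + (x $ b) *\<^sub>R c + (c \<bullet> x) *\<^sub>R axis b 1"
    by (simp only: vec_eq_iff) simp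
  then show ?thesis by (simp add: inner_add_right inner_axis inner_commute)
qed

lemma mult_b: "(M *v x) $ b = x $ b"
proof -
  have "(M *v x) $ b = (\<Sum>j\<in>UNIV. if b = j then x $ j else 0)"
    unfolding matrix_vector_mult_def vec_lambda_beta by (rule sum.cong) (auto simp: Mb)
  then show ?thesis by simp
qed

lemma quad_split: "x \<bullet> (M *v x) = (x - (x $ b) *\<^sub>R axis b 1) \<bullet> (M *v (x - (x $ b) *\<^sub>R axis b 1)) + (x $ b)^2"
proof -
  have 1: "M *v axis b 1 = axis b 1"
  proof -
    have "(M *v axis b 1) $ i = (\<Sum>j\<in>UNIV. if b = j then M $ i $ j else 0)" for i
      unfolding matrix_vector_mult_def vec_lambda_beta
      by (rule sum.cong) (auto simp: axis_def)
    then show ?thesis by (simp add: vec_eq_iff Mb') (simp add: axis_def)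
  qed
  have 2: "(M *v x) $ b = x $ b" by (rule mult_b)
  show ?thesis
    by (simp add: matrix_vector_mult_diff_distrib matrix_vector_mult_scaleR 1 inner_diff_left inner_diff_right
        inner_axis inner_axis' 2 power2_eq_square)
qed

context
  assumes det: "det M \<noteq> 0"
begin

lemma inv_facts: "M ** matrix_inv M = mat 1" "matrix_inv M ** M = mat 1"
  using det invertible_det_nz[of M] someI_ex[of "\<lambda>A'. M ** A' = mat 1 \<and> A' ** M = mat 1"]
  unfolding matrix_inv_def invertible_def by blast+

lemma M_a: "M *v (matrix_inv M *v c) = c"
  by (simp add: matrix_vector_mul_assoc inv_facts)

lemma a_b: "(matrix_inv M *v c) $ b = 0"
  using mult_b[of "matrix_inv M *v c"] by (simp add: M_a cb)

text \<open>
  The Schur complement formula. With \<open>a = M\<inverse> c\<close> and \<open>s = c \<bullet> a\<close> the bordered matrix factors as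
  \<open>L D L\<^sup>T\<close>, where \<open>D\<close> is \<open>M\<close> with its unit entry at \<open>b\<close> replaced by \<open>1 - s\<close>, and \<open>L\<close> is the
  identity with \<open>a\<close> added to row \<open>b\<close>, which has determinant one.
\<close>

lemma det_border: "det (border M b c) = (1 - c \<bullet> (matrix_inv M *v c)) * det M"
proof -
  define a where "a = matrix_inv M *v c"
  define s where "s = c \<bullet> a"
  define L where "L = (\<chi> i. if i = b then row b (mat 1) + a else row i (mat 1 :: real^'k^'k))"
  define D where "D = (\<chi> i. if i = b then (1 - s) *s (M $ b) else M $ i)"
  have ab: "a $ b = 0" and Ma: "M *v a = c" using a_b M_a by (auto simp: a_def)
  have aM: "(\<Sum>k\<in>UNIV. a $ k * M $ k $ j) = c $ j" for j
  proof -
    have "(\<Sum>k\<in>UNIV. a $ k * M $ k $ j) = (\<Sum>k\<in>UNIV. M $ j $ k * a $ k)"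
      by (rule sum.cong) (simp_all add: M_sym[of _ j])
    also have "\<dots> = (M *v a) $ j" by (simp add: matrix_vector_mult_def)
    finally show ?thesis by (simp add: Ma)
  qed
  have "a = (\<Sum>i\<in>UNIV. (a $ i) *s axis i 1)"
    by (rule basis_expansion[symmetric])
  also have "\<dots> = (\<Sum>i\<in>UNIV-{b}. (a $ i) *s axis i 1)"
    by (rule sum.mono_neutral_right) (auto simp: ab vec_eq_iff)
  finally have a_eq: "a = (\<Sum>i\<in>UNIV-{b}. (a $ i) *s axis i 1)" .
  have "a \<in> vec.span {row j (mat 1 :: real^'k^'k) |j. j \<noteq> b}"
    by (subst a_eq, intro vec.span_sum vec.span_scale vec.span_base)
       (auto simp: row_def mat_def axis_def vec_eq_iff)
  then have detL: "det L = 1"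
    unfolding L_def by (subst det_row_span) auto
  have detD: "det D = (1 - s) * det M"
    unfolding D_def by (subst det_row_mul) (auto intro!: arg_cong[of _ _ det] simp: vec_eq_iff)
  have Lij: "L $ i $ j = (if i = j then 1 else 0) + (if i = b then a $ j else 0)" for i j
    by (simp add: L_def row_def mat_def)
  have Dij: "D $ i $ j = M $ i $ j - (if i = b \<and> j = b then s else 0)" for i j
    by (simp add: D_def Mb)
  have LD: "(L ** D) $ i $ j = D $ i $ j + (if i = b then c $ j else 0)" for i j
  proof -
    have "(L ** D) $ i $ j = (\<Sum>k\<in>UNIV. (if i = k then D $ k $ j else 0) + (if i = b then a $ k * M $ k $ j else 0))"
      unfolding matrix_matrix_mult_def vec_lambda_beta
      by (rule sum.cong) (auto simp: Lij Dij ab algebra_simps)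
    then show ?thesis by (simp add: sum.distrib aM)
  qed
  have "border M b c = (L ** D) ** transpose L"
  proof -
    have "((L ** D) ** transpose L) $ i $ j = (\<Sum>k\<in>UNIV. (if j = k then (L ** D) $ i $ k else 0) +
        (if j = b then M $ i $ k * a $ k else 0) + (if j = b \<and> i = b then c $ k * a $ k else 0))" for i j
      unfolding matrix_matrix_mult_def[of "L ** D"] vec_lambda_beta transpose_def
      by (rule sum.cong) (auto simp: Lij LD Dij ab algebra_simps)
    moreover have "(\<Sum>k\<in>UNIV. M $ i $ k * a $ k) = c $ i" for i
      using arg_cong[OF Ma, of "\<lambda>v. v $ i"] by (simp add: matrix_vector_mult_def)
    moreover have "(\<Sum>k\<in>UNIV. c $ k * a $ k) = s" by (simp add: s_def inner_vec_def)
    ultimately have "((L ** D) ** transpose L) $ i $ j = (L ** D) $ i $ j +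
        (if j = b then c $ i else 0) + (if j = b \<and> i = b then s else 0)" for i j
      by (simp add: sum.distrib)
    then show ?thesis
      by (auto simp: vec_eq_iff border_def LD Dij cb)
  qed
  then show ?thesis by (simp add: det_mul detL detD s_def a_def)
qed

text \<open>
  The same factorisation, read as completing the square in the quadratic form. It yields the
  criterion for positive semidefiniteness below.
\<close>

lemma quad_border_complete_square:
  "x \<bullet> (border M b c *v x) = (x + (x $ b) *\<^sub>R (matrix_inv M *v c - axis b 1)) \<bullet>
     (M *v (x + (x $ b) *\<^sub>R (matrix_inv M *v c - axis b 1))) + (1 - c \<bullet> (matrix_inv M *v c)) * (x $ b)^2"
proof -
  define a where "a = matrix_inv M *v c"
  define y where "y = x - (x $ b) *\<^sub>R axis b 1"
  have y: "x + (x $ b) *\<^sub>R (a - axis b 1) = y + (x $ b) *\<^sub>R a" by (simp add: y_def algebra_simps)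
  have Ma: "M *v a = c" by (simp add: a_def M_a)
  have aMy: "a \<bullet> (M *v y) = c \<bullet> y"
    by (metis Ma dot_lmul_matrix sym transpose_matrix_vector)
  have cx: "c \<bullet> x = c \<bullet> y" by (simp add: y_def inner_diff_right inner_axis cb)
  have "x \<bullet> (border M b c *v x) = y \<bullet> (M *v y) + (x $ b)^2 + 2 * (x $ b) * (c \<bullet> y)"
    using quad_border[of x] quad_split[of x] by (simp only: cx y_def[symmetric])
  moreover have "(y + (x $ b) *\<^sub>R a) \<bullet> (M *v (y + (x $ b) *\<^sub>R a)) =
      y \<bullet> (M *v y) + 2 * (x $ b) * (c \<bullet> y) + (x $ b)^2 * (c \<bullet> a)"
    using aMy inner_commute[of y c] inner_commute[of a c]
    by (simp add: matrix_vector_right_distrib matrix_vector_mult_scaleR Ma inner_add_left inner_add_right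
        power2_eq_square distrib_left mult.assoc)
  moreover have "(1 - c \<bullet> a) * (x $ b)^2 = (x $ b)^2 - (x $ b)^2 * (c \<bullet> a)"
    by (simp add: algebra_simps)
  ultimately show ?thesis unfolding a_def[symmetric] y by linarith
qed

lemma pos_semidef_border_iff:
  assumes "pos_semidef M"
  shows "pos_semidef (border M b c) \<longleftrightarrow> c \<bullet> (matrix_inv M *v c) \<le> 1"
proof
  assume "c \<bullet> (matrix_inv M *v c) \<le> 1"
  moreover have "0 \<le> y \<bullet> (M *v y)" for y using assms by (simp add: pos_semidef_def)
  ultimately have "0 \<le> x \<bullet> (border M b c *v x)" for x
    unfolding quad_border_complete_square[of x] by (intro add_nonneg_nonneg mult_nonneg_nonneg) auto
  then show "pos_semidef (border M b c)"
    by (simp add: pos_semidef_def transpose_border)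
next
  assume *: "pos_semidef (border M b c)"
  define x where "x = axis b 1 - matrix_inv M *v c"
  have xb: "x $ b = 1" by (simp add: x_def a_b)
  then have "x + (x $ b) *\<^sub>R (matrix_inv M *v c - axis b 1) = 0" by (simp add: x_def)
  then have "x \<bullet> (border M b c *v x) = 1 - c \<bullet> (matrix_inv M *v c)"
    using quad_border_complete_square[of x] by (simp add: xb)
  moreover have "0 \<le> x \<bullet> (border M b c *v x)" using * by (simp add: pos_semidef_def)
  ultimately show "c \<bullet> (matrix_inv M *v c) \<le> 1" by simp
qed

end

text \<open>
  A nonsingular positive semidefinite matrix is positive definite, and this passes to the principal
  block. It makes the density of a larger family vanish wherever that of the smaller one does.
\<close>

lemma pos_def_border_imp:
  assumes "pos_semidef (border M b c)" "det (border M b c) \<noteq> 0"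
  shows "pos_semidef M" "det M \<noteq> 0"
proof -
  have pd: "0 < x \<bullet> (M *v x)" if "x \<noteq> 0" for x
  proof -
    define y where "y = x - (x $ b) *\<^sub>R axis b 1"
    have yb: "y $ b = 0" by (simp add: y_def)
    have q: "y \<bullet> (M *v y) = y \<bullet> (border M b c *v y)" by (simp add: quad_border yb)
    have s: "x \<bullet> (M *v x) = y \<bullet> (M *v y) + (x $ b)^2" unfolding y_def by (rule quad_split)
    show ?thesis
    proof (cases "y = 0")
      case True
      then have "x $ b \<noteq> 0" using that by (auto simp: y_def)
      then show ?thesis by (simp add: s True)
    next
      case False
      from pos_semidef_det_nz_imp_pos_def[OF assms False] show ?thesis
        unfolding s q by (simp add: add_pos_nonneg)
    qed
  qed
  show "pos_semidef M" unfolding pos_semidef_def using sym pd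
    by (metis inner_zero_left order_less_imp_le order_refl)
  show "det M \<noteq> 0"
  proof
    assume "det M = 0"
    then obtain x where "x \<noteq> 0" "M *v x = 0"
      by (metis invertible_det_nz invertible_left_inverse matrix_left_invertible_ker)
    with pd[of x] show False by simp
  qed
qed

end

section \<open>Coordinates adapted to a family of vectors\<close>

text \<open>
  Linear coordinates on \<open>\<real>\<^sup>n\<close> adapted to the vectors \<open>v i\<close>, \<open>i \<in> K\<close>: the first ones are the inner
  products with the \<open>v i\<close>, the others are orthonormal coordinates on the orthogonal complement of
  their span. The rows of \<open>A\<close> have \<open>G\<close>, padded by an identity, as their Gram matrix \<open>A A\<^sup>T\<close>;
  this gives the Jacobian \<open>|det A| = sqrt (det G)\<close> as well as the expression of the norm, since
  \<open>x \<bullet> x = y \<bullet> (A A\<^sup>T)\<inverse> y\<close> for \<open>y = A x\<close>.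
\<close>

lemma Gram_coordinates:
  fixes v :: "'k::finite \<Rightarrow> real^'n" and e :: "'k \<Rightarrow> 'n"
  assumes e: "inj e" and det: "det G \<noteq> 0"
    and G: "G = (\<chi> i j. if i \<in> K \<and> j \<in> K then v i \<bullet> v j else if i = j then 1 else 0)"
  obtains A :: "real^'n^'n"
  where "\<forall>i\<in>K. \<forall>x. (A *v x) $ e i = v i \<bullet> x"
    and "(det A)^2 = det G"
    and "\<forall>x c. c = (\<chi> i. if i \<in> K then v i \<bullet> x else 0) \<longrightarrow>
           x \<bullet> x = c \<bullet> (matrix_inv G *v c) + (\<Sum>j\<in>-(e ` K). ((A *v x) $ j)^2)"
proof -
  define U where "U = span (v ` K)"
  define V where "V = {y \<in> UNIV. \<forall>x\<in>U. orthogonal x y}"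
  have "dim U \<le> card K"
    unfolding U_def dim_span by (rule order_trans[OF dim_le_card']) (auto intro: card_image_le)
  moreover have "dim V + dim U = CARD('n)"
    unfolding V_def by (subst dim_subspace_orthogonal_to_vectors) (auto simp: U_def)
  ultimately have "CARD('n) - card K \<le> dim V" by linarith
  moreover have "card (- (e ` K)) = CARD('n) - card K"
    using e by (simp add: Compl_eq_Diff_UNIV card_Diff_subset card_image inj_on_subset)
  ultimately have card: "card (-(e ` K)) \<le> dim V" by simp
  have "subspace V" unfolding V_def by (simp add: subspace_orthogonal_to_vectors)
  from orthonormal_basis_subspace[OF this] obtain B where B: "B \<subseteq> V" "pairwise orthogonal B"
    "\<And>x. x \<in> B \<Longrightarrow> norm x = 1" "independent B" "card B = dim V" by metis
  have "finite B" using B by (simp add: independent_imp_finite)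
  with card B obtain w where w: "w ` (-(e ` K)) \<subseteq> B" "inj_on w (-(e ` K))"
    by (metis card_le_inj finite)
  have w_orth: "w i \<bullet> w j = (if i = j then 1 else 0)" if "i \<notin> e ` K" "j \<notin> e ` K" for i j
  proof (cases "i = j")
    case True
    have "w i \<in> B" using w(1) that(1) by blast
    then show ?thesis using B(3)[of "w i"] True by (simp add: dot_square_norm)
  next
    case False
    then have "w i \<noteq> w j" "w i \<in> B" "w j \<in> B" using w that by (auto dest: inj_onD)
    then show ?thesis using False B(2) by (auto simp: pairwise_def orthogonal_def)
  qed
  have v_w: "v i \<bullet> w j = 0" "w j \<bullet> v i = 0" if "i \<in> K" "j \<notin> e ` K" for i j
  proof -
    have "v i \<in> U" using that by (auto simp: U_def intro: span_base)
    moreover have "w j \<in> V" using w B(1) that by auto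
    ultimately show "v i \<bullet> w j = 0" "w j \<bullet> v i = 0"
      by (auto simp: V_def orthogonal_def inner_commute)
  qed
  define A :: "real^'n^'n" where "A = (\<chi> j. if j \<in> e ` K then v (inv e j) else w j)"
  have A_K: "A $ e i = v i" if "i \<in> K" for i using that e by (simp add: A_def)
  have A_w: "A $ j = w j" if "j \<notin> e ` K" for j using that by (simp add: A_def)
  have Ax: "(A *v x) $ j = A $ j \<bullet> x" for x j by (simp add: matrix_vector_mul_component)
  define N where "N = A ** transpose A"
  have N: "N $ i $ j = A $ i \<bullet> A $ j" for i j
    by (simp add: N_def matrix_matrix_mult_def transpose_def inner_vec_def)
  have N_out: "N $ i $ j = (if i = j then 1 else 0)" if "i \<notin> e ` K" for i j
  proof (cases "j \<in> e ` K")
    case True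
    with that show ?thesis by (auto simp: N A_K A_w v_w)
  next
    case False
    with that show ?thesis by (simp add: N A_w w_orth)
  qed
  have N_sym: "N $ i $ j = N $ j $ i" for i j by (simp add: N inner_commute)
  have N_in: "N $ e i $ e j = G $ i $ j" for i j
  proof (cases "i \<in> K \<and> j \<in> K")
    case True
    then show ?thesis by (simp add: N A_K G)
  next
    case False
    then have "e i \<notin> e ` K \<or> e j \<notin> e ` K" using e by (auto simp: inj_image_mem_iff)
    then have "N $ e i $ e j = (if e i = e j then 1 else 0)"
      using N_out[of "e i" "e j"] N_out[of "e j" "e i"] N_sym[of "e i" "e j"] by auto
    then show ?thesis using False e by (auto simp: G inj_eq)
  qed
  have "det N = det G"
  proof (rule det_inj_reindex[OF e N_in])
    show "N $ i $ j = (if i = j then 1 else 0)" if "i \<notin> range e" for i j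
      using that by (intro N_out) auto
  qed
  then have detA: "(det A)^2 = det G" by (simp add: N_def det_mul power2_eq_square)
  have invG: "G *v (matrix_inv G *v c) = c" for c
  proof -
    have "G ** matrix_inv G = mat 1"
      using det invertible_det_nz[of G] someI_ex[of "\<lambda>A'. G ** A' = mat 1 \<and> A' ** G = mat 1"]
      unfolding matrix_inv_def invertible_def by blast
    then show ?thesis by (simp add: matrix_vector_mul_assoc)
  qed
  have "x \<bullet> x = c \<bullet> (matrix_inv G *v c) + (\<Sum>j\<in>-(e ` K). ((A *v x) $ j)^2)"
    if c: "c = (\<chi> i. if i \<in> K then v i \<bullet> x else 0)" for x c
  proof -
    \<comment> \<open>\<open>a\<close> solves \<open>A A\<^sup>T a = A x\<close>, so that \<open>x = A\<^sup>T a\<close> and \<open>x \<bullet> x = a \<bullet> A x\<close>.\<close>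
    define \<alpha> where "\<alpha> = matrix_inv G *v c"
    have G\<alpha>: "(\<Sum>l\<in>UNIV. G $ i $ l * \<alpha> $ l) = c $ i" for i
      using arg_cong[OF invG[of c], of "\<lambda>u. u $ i"] by (simp add: \<alpha>_def matrix_vector_mult_def)
    define a where "a = (\<chi> j. if j \<in> e ` K then \<alpha> $ inv e j else (A *v x) $ j)"
    have a_in: "a $ e i = \<alpha> $ i" if "i \<in> K" for i using that e by (simp add: a_def)
    have \<alpha>_out: "\<alpha> $ i = 0" if "i \<notin> K" for i
    proof -
      have "(\<Sum>l\<in>UNIV. G $ i $ l * \<alpha> $ l) = (\<Sum>l\<in>UNIV. if i = l then \<alpha> $ l else 0)"
        using that by (intro sum.cong) (auto simp: G)
      then show ?thesis using G\<alpha>[of i] that by (simp add: c)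
    qed
    have "(N *v a) $ j = (A *v x) $ j" for j
    proof (cases "j \<in> e ` K")
      case True
      then obtain i where i: "i \<in> K" "j = e i" by auto
      have "(N *v a) $ j = (\<Sum>l\<in>UNIV. N $ e i $ l * a $ l)" by (simp add: matrix_vector_mult_def i)
      also have "\<dots> = (\<Sum>l\<in>e ` K. N $ e i $ l * a $ l)"
        using i N_out N_sym[of "e i"] by (intro sum.mono_neutral_right) auto
      also have "\<dots> = (\<Sum>l\<in>K. G $ i $ l * \<alpha> $ l)"
        using e by (simp add: sum.reindex inj_on_subset N_in a_in)
      also have "\<dots> = (\<Sum>l\<in>UNIV. G $ i $ l * \<alpha> $ l)"
        by (rule sum.mono_neutral_left) (auto simp: \<alpha>_out)
      also have "\<dots> = v i \<bullet> x" using i by (simp add: G\<alpha> c)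
      finally show ?thesis using i by (simp add: Ax A_K)
    next
      case False
      have "(N *v a) $ j = (\<Sum>l\<in>UNIV. if j = l then a $ l else 0)"
        unfolding matrix_vector_mult_def vec_lambda_beta by (rule sum.cong) (auto simp: N_out[OF False])
      then show ?thesis using False by (simp add: a_def)
    qed
    then have "A *v (transpose A *v a) = A *v x"
      unfolding vec_eq_iff N_def matrix_vector_mul_assoc by blast
    moreover have "det A \<noteq> 0" using detA det by auto
    then have "inj ((*v) A)" using det_nz_iff_inj[of "(*v) A"] by simp
    ultimately have x: "x = transpose A *v a" by (simp add: inj_eq)
    have "x \<bullet> x = (transpose A *v a) \<bullet> x" using x by simp
    also have "\<dots> = a \<bullet> (A *v x)" by (simp add: dot_lmul_matrix)
    also have "\<dots> = (\<Sum>j\<in>e ` K. a $ j * (A *v x) $ j) + (\<Sum>j\<in>-(e ` K). a $ j * (A *v x) $ j)"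
      unfolding inner_vec_def by (subst sum.union_disjoint[symmetric]) (auto intro!: sum.cong)
    also have "(\<Sum>j\<in>e ` K. a $ j * (A *v x) $ j) = (\<Sum>i\<in>K. \<alpha> $ i * c $ i)"
      using e by (simp add: sum.reindex inj_on_subset a_in Ax A_K c)
    also have "\<dots> = (\<Sum>i\<in>UNIV. \<alpha> $ i * c $ i)"
      by (rule sum.mono_neutral_left) (auto simp: \<alpha>_out)
    also have "\<dots> = c \<bullet> \<alpha>" by (simp add: inner_vec_def mult.commute)
    also have "(\<Sum>j\<in>-(e ` K). a $ j * (A *v x) $ j) = (\<Sum>j\<in>-(e ` K). ((A *v x) $ j)^2)"
      by (rule sum.cong) (auto simp: a_def power2_eq_square)
    finally show ?thesis by (simp add: \<alpha>_def)
  qed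
  with detA show thesis using Ax A_K that[of A] by simp
qed

section \<open>Lebesgue measure in coordinates\<close>

text \<open>
  By uniqueness of Lebesgue measure it suffices to look at boxes, whose preimages under \<open>A\<close> are
  images under the inverse matrix.
\<close>

lemma lborel_linear_image:
  fixes A :: "real^'n::{finite,wellorder}^'n::_"
  assumes det: "det A \<noteq> 0"
  shows "lborel = density (distr lborel borel ((*v) A)) (\<lambda>_. ennreal \<bar>det A\<bar>)"
proof (rule lborel_eqI)
  have [measurable]: "(*v) A \<in> borel_measurable borel"
    by (intro borel_measurable_continuous_onI linear_continuous_on matrix_vector_mul_bounded_linear)
  obtain B where AB: "A ** B = mat 1" "B ** A = mat 1"
    using det by (metis invertible_def invertible_det_nz)
  fix l u :: "real^'n::_" assume le: "\<And>b. b \<in> Basis \<Longrightarrow> l \<bullet> b \<le> u \<bullet> b"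
  have pre: "(*v) A -` box l u = (*v) B ` box l u"
  proof (intro set_eqI iffI)
    fix x assume "x \<in> (*v) A -` box l u"
    then show "x \<in> (*v) B ` box l u"
      by (intro image_eqI[of _ _ "A *v x"]) (auto simp: matrix_vector_mul_assoc AB)
  qed (auto simp: matrix_vector_mul_assoc AB)
  have dAB: "\<bar>det A\<bar> * \<bar>det B\<bar> = 1"
    using arg_cong[OF AB(1), of det] by (simp add: det_mul flip: abs_mult)
  have m: "(*v) B ` box l u \<in> lmeasurable" "measure lebesgue ((*v) B ` box l u) = \<bar>det B\<bar> * measure lebesgue (box l u)"
    using measurable_linear_image[of "(*v) B" "box l u"] measure_linear_image[of "(*v) B" "box l u"] by auto
  have "(*v) A -` box l u \<in> sets borel"
    using measurable_sets_borel[of "(*v) A" borel "box l u"] by auto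
  then have "emeasure lborel ((*v) A -` box l u) = emeasure lebesgue ((*v) A -` box l u)" by simp
  also have "\<dots> = ennreal (\<bar>det B\<bar> * measure lebesgue (box l u))"
    unfolding pre using m emeasure_eq_measure2 by metis
  also have "measure lebesgue (box l u) = (\<Prod>b\<in>Basis. (u - l) \<bullet> b)"
    using le by (simp add: measure_lborel_box_eq inner_diff_left)
  finally have "emeasure lborel ((*v) A -` box l u) = ennreal (\<bar>det B\<bar> * (\<Prod>b\<in>Basis. (u - l) \<bullet> b))" .
  then show "emeasure (density (distr lborel borel ((*v) A)) (\<lambda>_. ennreal \<bar>det A\<bar>)) (box l u)
      = (\<Prod>b\<in>Basis. (u - l) \<bullet> b)"
    using dAB by (simp add: emeasure_density_const emeasure_distr flip: ennreal_mult' mult.assoc)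
qed simp

lemma nn_integral_linear_image:
  fixes A :: "real^'n::{finite,wellorder}^'n::_"
  assumes det: "det A \<noteq> 0" and [measurable]: "h \<in> borel_measurable borel"
  shows "(\<integral>\<^sup>+ x. h (A *v x) \<partial>lborel) = ennreal (1 / \<bar>det A\<bar>) * (\<integral>\<^sup>+ y. h y \<partial>lborel)"
proof -
  have [measurable]: "(*v) A \<in> borel_measurable borel"
    by (intro borel_measurable_continuous_onI linear_continuous_on matrix_vector_mul_bounded_linear)
  have "(\<integral>\<^sup>+ y. h y \<partial>lborel) = ennreal \<bar>det A\<bar> * (\<integral>\<^sup>+ x. h (A *v x) \<partial>lborel)"
    by (subst lborel_linear_image[OF det])
       (simp add: nn_integral_density nn_integral_distr nn_integral_cmult)
  then show ?thesis
    using det by (simp flip: mult.assoc ennreal_mult')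
qed

interpretation lborel_prod: product_sigma_finite "\<lambda>_. lborel :: real measure"
  by standard

lemma split_coordinates_measurable:
  fixes e :: "'j \<Rightarrow> 'n::finite"
  assumes J: "finite J" and e: "inj_on e J"
  shows "(\<lambda>(c, z). (\<chi> i. if i \<in> e ` J then c (inv_into J e i) else z i) :: real^'n) \<in>
    borel_measurable ((\<Pi>\<^sub>M j\<in>J. lborel) \<Otimes>\<^sub>M (\<Pi>\<^sub>M i\<in>-(e ` J). lborel))"
    (is "?f \<in> borel_measurable ?P")
proof (subst borel_measurable_euclidean_space, safe)
  fix b :: "real^'n" assume "b \<in> Basis"
  then obtain i where b: "b = axis i 1" by (auto simp: Basis_vec_def)
  have [measurable]: "(\<lambda>x. x j) \<in> borel_measurable (\<Pi>\<^sub>M j\<in>J. lborel :: real measure)" if "j \<in> J" for j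
    using measurable_component_singleton[OF that, of "\<lambda>_. lborel :: real measure"] by simp
  have [measurable]: "(\<lambda>x. x j) \<in> borel_measurable (\<Pi>\<^sub>M j\<in>-(e ` J). lborel :: real measure)" if "j \<notin> e ` J" for j
    using that measurable_component_singleton[of j "-(e`J)" "\<lambda>_. lborel :: real measure"] by simp
  have "(\<lambda>p. if i \<in> e ` J then fst p (inv_into J e i) else snd p i) \<in> borel_measurable ?P"
  proof (cases "i \<in> e ` J")
    case True
    then have [measurable]: "(\<lambda>x. x (inv_into J e i)) \<in> borel_measurable (\<Pi>\<^sub>M j\<in>J. lborel :: real measure)"
      by (simp add: inv_into_into)
    then show ?thesis using True by simp
  next
    case False
    then have [measurable]: "(\<lambda>x. x i) \<in> borel_measurable (\<Pi>\<^sub>M j\<in>-(e ` J). lborel :: real measure)"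
      by simp
    then show ?thesis using False by simp
  qed
  then show "(\<lambda>p. ?f p \<bullet> b) \<in> borel_measurable ?P"
    by (simp add: b inner_axis split_beta)
qed

text \<open>
  Lebesgue measure on \<open>\<real>\<^sup>n\<close> as a product of two product measures. The first block of coordinates
  is renamed along \<open>e\<close>, so that it can be indexed by whatever labels the inner products carry.
\<close>

lemma lborel_split_coordinates:
  fixes e :: "'j \<Rightarrow> 'n::finite"
  assumes J: "finite J" and e: "inj_on e J"
  shows "(lborel :: (real^'n) measure) = distr ((\<Pi>\<^sub>M j\<in>J. lborel) \<Otimes>\<^sub>M (\<Pi>\<^sub>M i\<in>-(e ` J). lborel)) borel
           (\<lambda>(c, z). \<chi> i. if i \<in> e ` J then c (inv_into J e i) else z i)" (is "_ = distr ?P borel ?f")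
proof (rule lborel_eqI)
  interpret Z: sigma_finite_measure "\<Pi>\<^sub>M i\<in>-(e ` J). lborel :: real measure"
    by (rule lborel_prod.sigma_finite) simp
  have f: "?f \<in> borel_measurable ?P" by (rule split_coordinates_measurable[OF J e])
  fix l u :: "real^'n" assume le: "\<And>b. b \<in> Basis \<Longrightarrow> l \<bullet> b \<le> u \<bullet> b"
  have le': "l $ i \<le> u $ i" for i using le[of "axis i 1"] by (simp add: inner_axis axis_in_Basis_iff)
  have pre: "?f -` box l u \<inter> space ?P =
      (\<Pi>\<^sub>E j\<in>J. {l $ e j <..< u $ e j}) \<times> (\<Pi>\<^sub>E i\<in>-(e ` J). {l $ i <..< u $ i})" (is "_ = ?R")
  proof (intro set_eqI iffI)
    fix p assume p: "p \<in> ?f -` box l u \<inter> space ?P"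
    then have sp: "fst p \<in> extensional J" "snd p \<in> extensional (-(e ` J))"
      by (auto simp: space_pair_measure space_PiM PiE_def)
    have *: "l $ i < (if i \<in> e ` J then fst p (inv_into J e i) else snd p i)"
      "(if i \<in> e ` J then fst p (inv_into J e i) else snd p i) < u $ i" for i
      using p by (auto simp: mem_box_cart split_beta)
    have "l $ e j < fst p j \<and> fst p j < u $ e j" if "j \<in> J" for j
      using *[of "e j"] that e by simp
    moreover have "l $ i < snd p i \<and> snd p i < u $ i" if "i \<notin> e ` J" for i
      using *[of i] that by simp
    ultimately show "p \<in> ?R" using sp by (auto simp: mem_Times_iff PiE_def)
  next
    fix p assume p: "p \<in> ?R"
    have "l $ i < ?f p $ i \<and> ?f p $ i < u $ i" for i
    proof (cases "i \<in> e ` J")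
      case True
      then obtain j where "j \<in> J" "i = e j" by auto
      then show ?thesis using p e by (auto simp: mem_Times_iff split_beta PiE_def Pi_def)
    next
      case False
      then show ?thesis using p by (auto simp: mem_Times_iff split_beta PiE_def Pi_def)
    qed
    then show "p \<in> ?f -` box l u \<inter> space ?P"
      using p by (auto simp: mem_box_cart space_pair_measure space_PiM mem_Times_iff PiE_def)
  qed
  have "emeasure (distr ?P borel ?f) (box l u) = emeasure ?P ?R"
    using f pre by (subst emeasure_distr) auto
  also have "\<dots> = emeasure (\<Pi>\<^sub>M j\<in>J. lborel) (\<Pi>\<^sub>E j\<in>J. {l $ e j <..< u $ e j}) *
      emeasure (\<Pi>\<^sub>M i\<in>-(e ` J). lborel) (\<Pi>\<^sub>E i\<in>-(e ` J). {l $ i <..< u $ i})"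
    using J by (intro Z.emeasure_pair_measure_Times sets_PiM_I_finite) auto
  also have "\<dots> = (\<Prod>j\<in>J. ennreal (u $ e j - l $ e j)) * (\<Prod>i\<in>-(e ` J). ennreal (u $ i - l $ i))"
    using J le' by (simp add: lborel_prod.emeasure_PiM)
  also have "(\<Prod>j\<in>J. ennreal (u $ e j - l $ e j)) = (\<Prod>i\<in>e ` J. ennreal (u $ i - l $ i))"
    using e by (simp add: prod.reindex)
  also have "\<dots> * (\<Prod>i\<in>-(e ` J). ennreal (u $ i - l $ i)) = (\<Prod>i\<in>UNIV. ennreal (u $ i - l $ i))"
    by (subst prod.union_disjoint[symmetric]) (auto intro!: prod.cong)
  also have "\<dots> = ennreal (\<Prod>b\<in>Basis. (u - l) \<bullet> b)"
  proof -
    have Basis: "(Basis :: (real^'n) set) = range (\<lambda>i. axis i 1)"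
      by (auto simp: Basis_vec_def)
    have "(\<Prod>b\<in>Basis. (u - l) \<bullet> b) = (\<Prod>i\<in>UNIV. (u - l) \<bullet> axis i 1)"
      unfolding Basis by (subst prod.reindex) (auto simp: inj_on_def axis_eq_axis)
    then show ?thesis using le' by (simp add: prod_ennreal inner_axis)
  qed
  finally show "emeasure (distr ?P borel ?f) (box l u) = ennreal (\<Prod>b\<in>Basis. (u - l) \<bullet> b)" .
qed simp

lemma PiM_lborel_scale:
  assumes J: "finite J" and r: "r > 0"
    and H[measurable]: "H \<in> borel_measurable (\<Pi>\<^sub>M j\<in>J. lborel :: real measure)"
  shows "(\<integral>\<^sup>+ c. H c \<partial>(\<Pi>\<^sub>M j\<in>J. lborel)) =
           ennreal (r ^ card J) * (\<integral>\<^sup>+ c. H (\<lambda>j\<in>J. r * c j) \<partial>(\<Pi>\<^sub>M j\<in>J. lborel))"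
proof -
  let ?P = "\<Pi>\<^sub>M j\<in>J. lborel :: real measure"
  have m[measurable]: "(\<lambda>c. \<lambda>j\<in>J. r * c j) \<in> measurable ?P ?P"
    by measurable
  have "density (distr ?P ?P (\<lambda>c. \<lambda>j\<in>J. r * c j)) (\<lambda>_. ennreal (r ^ card J)) = ?P"
  proof (rule lborel_prod.PiM_eqI[OF J])
    fix X :: "'a \<Rightarrow> real set" assume "\<And>j. j \<in> J \<Longrightarrow> X j \<in> sets lborel"
    then have X: "\<And>j. j \<in> J \<Longrightarrow> X j \<in> sets borel" by simp
    have pre: "(\<lambda>c. \<lambda>j\<in>J. r * c j) -` Pi\<^sub>E J X \<inter> space ?P = (\<Pi>\<^sub>E j\<in>J. (\<lambda>t. r * t) -` X j)"
      by (auto simp: space_PiM PiE_def Pi_def)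
    have 1: "(\<lambda>t. r * t) -` X j \<in> sets borel" if "j \<in> J" for j
      using measurable_sets_borel[of "\<lambda>t. r * t" borel "X j"] X[OF that] by simp
    have 2: "emeasure lborel (X j) = ennreal r * emeasure lborel ((\<lambda>t. r * t) -` X j)" if "j \<in> J" for j
      using r X[OF that] 1[OF that] by (subst lborel_real_affine[of r 0])
         (simp_all add: emeasure_density_const emeasure_distr)
    have "emeasure (density (distr ?P ?P (\<lambda>c. \<lambda>j\<in>J. r * c j)) (\<lambda>_. ennreal (r ^ card J))) (Pi\<^sub>E J X)
      = ennreal (r ^ card J) * emeasure ?P (\<Pi>\<^sub>E j\<in>J. (\<lambda>t. r * t) -` X j)"
      using J X by (simp add: emeasure_density_const emeasure_distr pre sets_PiM_I_finite)
    also have "\<dots> = ennreal (r ^ card J) * (\<Prod>j\<in>J. emeasure lborel ((\<lambda>t. r * t) -` X j))"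
      using J 1 by (simp add: lborel_prod.emeasure_PiM)
    also have "\<dots> = (\<Prod>j\<in>J. emeasure lborel (X j))"
      using r by (simp add: 2 prod.distrib ennreal_power)
    finally show "emeasure (density (distr ?P ?P (\<lambda>c. \<lambda>j\<in>J. r * c j)) (\<lambda>_. ennreal (r ^ card J))) (Pi\<^sub>E J X) = 
      (\<Prod>j\<in>J. emeasure lborel (X j))" .
  qed simp
  then have "(\<integral>\<^sup>+ c. H c \<partial>?P) = (\<integral>\<^sup>+ c. H c \<partial>density (distr ?P ?P (\<lambda>c. \<lambda>j\<in>J. r * c j)) (\<lambda>_. ennreal (r ^ card J)))"
    by simp
  also have "\<dots> = ennreal (r ^ card J) * (\<integral>\<^sup>+ c. H (\<lambda>j\<in>J. r * c j) \<partial>?P)"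
    by (simp add: nn_integral_density nn_integral_distr nn_integral_cmult)
  finally show ?thesis .
qed

text \<open>
  The distribution function of the squared norm under Lebesgue measure is the volume of a ball of
  radius \<open>sqrt r\<close>, and the density is its derivative. Working with the squared norm avoids polar
  coordinates.
\<close>

lemma distr_sum_squares_PiM_lborel:
  fixes I :: "'i set"
  assumes I: "finite I" "I \<noteq> {}"
  defines "d \<equiv> real (card I)"
  shows "distr (\<Pi>\<^sub>M i\<in>I. lborel) borel (\<lambda>z. \<Sum>i\<in>I. (z i)\<^sup>2) =
    density lborel (\<lambda>t. ennreal (unit_ball_vol d * (d / 2) * t powr (d / 2 - 1)) * indicator {0<..} t)"
    (is "?M = ?N")
proof -
  let ?P = "\<Pi>\<^sub>M i\<in>I. lborel :: real measure"
  have d: "d > 0" using I by (simp add: d_def card_gt_0_iff)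
  have [measurable]: "(\<lambda>z. \<Sum>i\<in>I. (z i)\<^sup>2) \<in> borel_measurable ?P" by measurable
  have M: "emeasure ?M {..r} = ennreal (unit_ball_vol d * r powr (d / 2))" if "r > 0" for r
  proof -
    have "emeasure ?M {..r} = emeasure ?P ({z. sqrt (\<Sum>i\<in>I. (z i)\<^sup>2) \<le> sqrt r} \<inter> space ?P)"
      by (subst emeasure_distr) (auto intro!: arg_cong[of _ _ "emeasure ?P"])
    also have "\<dots> = ennreal (unit_ball_vol d * sqrt r ^ card I)"
      unfolding d_def using that I by (intro emeasure_cball_aux) auto
    also have "sqrt r ^ card I = r powr (d / 2)"
      using that by (simp add: d_def powr_half_sqrt[symmetric] powr_powr flip: powr_realpow)
    finally show ?thesis .
  qed
  \<comment> \<open>The ball formula needs a positive radius, so radius zero is reached by a limit.\<close>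
  have M0: "emeasure ?M {..0} = 0"
  proof -
    have "emeasure ?M {..0} \<le> ennreal (unit_ball_vol d * r powr (d / 2))" if "r > 0" for r
      using emeasure_mono[of "{..0}" "{..r}" ?M] M[OF that] that by auto
    moreover have "((\<lambda>r. ennreal (unit_ball_vol d * r powr (d / 2))) \<longlongrightarrow> ennreal (unit_ball_vol d * 0)) (at_right 0)"
      using d by (intro tendsto_ennrealI tendsto_mult tendsto_const tendsto_zero_powrI[where b = "d / 2"])
        (auto simp: eventually_at_right_less eventually_at_filter)
    ultimately have "emeasure ?M {..0} \<le> ennreal (unit_ball_vol d * 0)"
      by (intro tendsto_lowerbound[of _ _ "at_right 0"]) (auto simp: eventually_at_right_less intro!: eventually_mono[OF eventually_at_right_less])
    then show ?thesis by simp
  qed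
  have N: "emeasure ?N {..r} = ennreal (unit_ball_vol d * r powr (d / 2))" if "r > 0" for r
  proof -
    have "emeasure ?N {..r} = (\<integral>\<^sup>+ t. ennreal (unit_ball_vol d * (d / 2) * t powr (d / 2 - 1)) * indicator {0..r} t \<partial>lborel)"
      by (subst emeasure_density) (auto intro!: nn_integral_cong split: split_indicator)
    also have "\<dots> = ennreal (unit_ball_vol d * r powr (d / 2))"
    proof -
      have "((\<lambda>t. t powr (d / 2 - 1)) has_integral (r powr (d / 2 - 1 + 1) / (d / 2 - 1 + 1))) {0..r}"
        using d that by (intro has_integral_powr_from_0) auto
      then have "((\<lambda>t. t powr (d / 2 - 1)) has_integral (r powr (d / 2) / (d / 2))) {0..r}" by simp
      from has_integral_mult_right[OF this, of "unit_ball_vol d * (d / 2)"]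
      have "((\<lambda>t. unit_ball_vol d * (d / 2) * t powr (d / 2 - 1)) has_integral unit_ball_vol d * r powr (d / 2)) {0..r}"
        using d by simp
      from nn_integral_has_integral_lebesgue[OF _ this] d
      have "(\<integral>\<^sup>+ t. ennreal (indicator {0..r} t * (unit_ball_vol d * (d / 2) * t powr (d / 2 - 1))) \<partial>lborel) =
          ennreal (unit_ball_vol d * r powr (d / 2))" by simp
      moreover have "ennreal (unit_ball_vol d * (d / 2) * t powr (d / 2 - 1)) * indicator {0..r} t =
          ennreal (indicator {0..r} t * (unit_ball_vol d * (d / 2) * t powr (d / 2 - 1)))" for t
        by (simp split: split_indicator)
      ultimately show ?thesis by simp
    qed
    finally show ?thesis .
  qed
  have N0: "emeasure ?N {..0} = 0"
    by (subst emeasure_density) (auto simp: nn_integral_0_iff_AE split: split_indicator)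
  have eq: "emeasure ?M {..r} = emeasure ?N {..r}" for r
  proof (cases "r > 0")
    case True
    then show ?thesis by (simp only: M N)
  next
    case False
    then have "emeasure ?M {..r} \<le> emeasure ?M {..0}" "emeasure ?N {..r} \<le> emeasure ?N {..0}"
      by (intro emeasure_mono; simp)+
    then show ?thesis using M0 N0 by simp
  qed
  show ?thesis
  proof (rule measure_eqI_generator_eq[where E = "range atMost" and \<Omega> = UNIV and A = "\<lambda>n. {..real n}"])
    show "Int_stable (range atMost :: real set set)"
      by (auto simp: Int_stable_def Int_atMost)
    show "emeasure ?M {..real n} \<noteq> \<infinity>" for n
      using M[of "real n"] M0 by (cases "n = 0") auto
    show "(\<Union>n. {..real n}) = UNIV" by (auto intro: real_arch_simple)
    show "emeasure ?M X = emeasure ?N X" if "X \<in> range atMost" for X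
      using that eq by (elim imageE) (simp only:)
    have "sets borel = sigma_sets UNIV (range (atMost :: real \<Rightarrow> _))"
      by (subst borel_eq_atMost) simp
    then show "sets ?M = sigma_sets UNIV (range atMost)" "sets ?N = sigma_sets UNIV (range atMost)"
      by (simp_all only: sets_distr sets_density sets_lborel)
  qed auto
qed

section \<open>Inner products with a uniform random unit vector\<close>

lemma nn_integral_uniform_sphere:
  fixes h :: "real^'n \<Rightarrow> ennreal"
  assumes [measurable]: "h \<in> borel_measurable borel"
  shows "(\<integral>\<^sup>+ w. h w \<partial>uniform_sphere) =
    (\<integral>\<^sup>+ x. h (sgn x) * indicator (ball 0 1) x \<partial>lborel) / emeasure lborel (ball (0::real^'n) 1)"
proof -
  have "(\<integral>\<^sup>+ w. h w \<partial>uniform_sphere) =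
      (\<integral>\<^sup>+ x. h (sgn x) * indicator (sphere 0 1) (sgn x) * indicator (ball 0 1) x \<partial>lborel) / emeasure lborel (ball (0::real^'n) 1)"
  proof -
    have [measurable]: "sphere (0::real^'n) 1 \<in> sets borel" "ball (0::real^'n) 1 \<in> sets borel" by auto
    have "(\<integral>\<^sup>+ w. h w \<partial>uniform_sphere) =
        (\<integral>\<^sup>+ w. h w * indicator (sphere 0 1) w \<partial>distr (uniform_measure lborel (ball 0 1)) borel sgn)"
      unfolding uniform_sphere_def by (rule nn_integral_restrict_space) simp
    also have "\<dots> = (\<integral>\<^sup>+ x. h (sgn x) * indicator (sphere 0 1) (sgn x) \<partial>uniform_measure lborel (ball 0 1))"
      by (rule nn_integral_distr) measurable
    also have "\<dots> = (\<integral>\<^sup>+ x. h (sgn x) * indicator (sphere 0 1) (sgn x) * indicator (ball 0 1) x \<partial>lborel) /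
        emeasure lborel (ball (0::real^'n) 1)"
      by (rule nn_integral_uniform_measure) measurable
    finally show ?thesis .
  qed
  also have "(\<integral>\<^sup>+ x. h (sgn x) * indicator (sphere 0 1) (sgn x) * indicator (ball 0 1) x \<partial>lborel) =
      (\<integral>\<^sup>+ x. h (sgn x) * indicator (ball 0 1) x \<partial>lborel)"
  proof (rule nn_integral_cong_AE)
    show "AE x in lborel. h (sgn x) * indicator (sphere 0 1) (sgn x) * indicator (ball 0 1) x =
            h (sgn x) * indicator (ball (0::real^'n) 1) x"
      using AE_lborel_singleton[of 0] by eventually_elim (simp add: norm_sgn)
  qed
  finally show ?thesis .
qed

text \<open>
  The constant of the density of the squared norm: half the surface area of the unit sphere.
\<close>

lemma unit_ball_vol_Gamma:
  assumes "d > 0"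
  shows "unit_ball_vol d * (d / 2) = pi powr (d / 2) / Gamma (d / 2)"
proof -
  have "d / 2 \<notin> \<int>\<^sub>\<le>\<^sub>0" using assms by (auto elim!: nonpos_Ints_cases)
  then have "Gamma (d / 2 + 1) = d / 2 * Gamma (d / 2)" by (rule Gamma_plus1)
  moreover have "Gamma (d / 2) > 0" using assms by simp
  ultimately show ?thesis using assms by (simp add: unit_ball_vol_def)
qed

lemma nn_integral_powr_0_1:
  assumes "b > 0"
  shows "(\<integral>\<^sup>+ q. ennreal (q powr (b - 1)) * indicator {0<..<1} q \<partial>lborel) = ennreal (1 / b)"
proof -
  have "((\<lambda>q. q powr (b - 1)) has_integral (1 powr (b - 1 + 1) / (b - 1 + 1))) {0..1}"
    using assms by (intro has_integral_powr_from_0) auto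
  then have "((\<lambda>q. q powr (b - 1)) has_integral (1 / b)) {0..1}" by simp
  from nn_integral_has_integral_lebesgue[OF _ this]
  have "(\<integral>\<^sup>+ q. ennreal (indicator {0..1} q * q powr (b - 1)) \<partial>lborel) = ennreal (1 / b)" by simp
  moreover have "(\<integral>\<^sup>+ q. ennreal (q powr (b - 1)) * indicator {0<..<1} q \<partial>lborel) =
      (\<integral>\<^sup>+ q. ennreal (indicator {0..1} q * q powr (b - 1)) \<partial>lborel)"
  proof (rule nn_integral_cong_AE)
    show "AE q in lborel. ennreal (q powr (b - 1)) * indicator {0<..<1} q = ennreal (indicator {0..1} q * q powr (b - 1))"
      using AE_lborel_singleton[of 0] AE_lborel_singleton[of 1]
      by eventually_elim (auto split: split_indicator)
  qed
  ultimately show ?thesis by simp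
qed

text \<open>
  The joint law of the inner products \<open>u j \<bullet> w\<close> with a uniform unit vector \<open>w\<close>, given coordinates
  \<open>A\<close> in which the \<open>u j \<bullet> x\<close> are the first ones and \<open>|x|\<^sup>2 = s(c) + |z|\<^sup>2\<close>, with \<open>c\<close> the first and
  \<open>z\<close> the remaining coordinates. Write \<open>w = x / |x|\<close> with \<open>x\<close> in the unit ball. In terms of \<open>c\<close> and
  \<open>q = |x|\<^sup>2\<close> Lebesgue measure has density proportional to \<open>(q - s(c))\<^bsup>d/2-1\<^esup>\<close> on \<open>q > s(c)\<close>,
  because \<open>q\<close> is \<open>|z|\<^sup>2\<close> shifted by \<open>s(c)\<close>. For fixed \<open>q\<close> the substitution \<open>c = sqrt q c'\<close> is linear
  and turns this into \<open>q\<^bsup>n/2-1\<^esup> (1 - s(c'))\<^bsup>d/2-1\<^esup>\<close>, where \<open>c'\<close> are the inner products with \<open>w\<close>.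
  So \<open>q\<close> integrates out. Exchanging \<open>c\<close> for \<open>c'\<close> only at fixed \<open>q\<close> is what keeps every change of
  variables linear. For \<open>s(c) \<ge> 1\<close> the factor is \<open>0 powr (d/2-1) = 0\<close>.
\<close>

lemma uniform_sphere_linear_functionals:
  fixes A :: "real^'n::{finite,wellorder}^'n::_" and e :: "'j \<Rightarrow> 'n" and u :: "'j \<Rightarrow> real^'n::_"
    and s :: "('j \<Rightarrow> real) \<Rightarrow> real"
  defines "n \<equiv> real CARD('n)"
  assumes J: "finite J" "inj_on e J" "e ` J \<noteq> UNIV" and det: "det A \<noteq> 0"
    and Au: "\<And>j x. j \<in> J \<Longrightarrow> (A *v x) $ e j = u j \<bullet> x"
    and s_meas[measurable]: "s \<in> borel_measurable (\<Pi>\<^sub>M j\<in>J. lborel)"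
    and s_nonneg: "\<And>c. 0 \<le> s c"
    and s_scale: "\<And>r c. s (\<lambda>j\<in>J. r * c j) = r^2 * s c"
    and norm_eq: "\<And>x. x \<bullet> x = s (\<lambda>j\<in>J. u j \<bullet> x) + (\<Sum>i\<in>-(e ` J). ((A *v x) $ i)^2)"
    and H[measurable]: "H \<in> borel_measurable (\<Pi>\<^sub>M j\<in>J. lborel)"
    and d: "d = n - real (card J)"
  shows "(\<integral>\<^sup>+ w. H (\<lambda>j\<in>J. u j \<bullet> w) \<partial>uniform_sphere) =
    ennreal (Gamma (n / 2) / (pi powr (real (card J) / 2) * Gamma (d / 2)) / \<bar>det A\<bar>) *
    (\<integral>\<^sup>+ c. ennreal (max 0 (1 - s c) powr (d / 2 - 1)) * H c \<partial>(\<Pi>\<^sub>M j\<in>J. lborel))"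
proof -
  let ?P = "\<Pi>\<^sub>M j\<in>J. lborel :: real measure"
  let ?Z = "\<Pi>\<^sub>M i\<in>-(e ` J). lborel :: real measure"
  define m where "m = card J"
  define a where "a = d / 2 - 1"
  define \<omega> where "\<omega> = unit_ball_vol d * (d / 2)"
  interpret P: sigma_finite_measure ?P using J by (intro lborel_prod.sigma_finite)
  interpret Z: sigma_finite_measure ?Z by (intro lborel_prod.sigma_finite) simp
  interpret PL: pair_sigma_finite ?P "lborel :: real measure" ..
  have cardZ: "real (card (-(e ` J))) = d"
  proof -
    have "card J \<le> CARD('n)" using J card_inj_on_le[of e J UNIV] by simp
    then show ?thesis using J d
      by (simp add: Compl_eq_Diff_UNIV card_Diff_subset card_image n_def of_nat_diff)
  qed
  have neZ: "-(e ` J) \<noteq> {}" using J by auto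
  have dpos: "d > 0" using neZ cardZ by (metis card_gt_0_iff finite of_nat_0_less_iff)
  have npos: "n > 0" by (simp add: n_def)
  have \<omega>pos: "\<omega> \<ge> 0" using dpos by (simp add: \<omega>_def)
  have sumsq: "(\<lambda>z. \<Sum>i\<in>-(e ` J). (z i)\<^sup>2) \<in> borel_measurable ?Z" by measurable
  have [measurable]: "(\<lambda>x. x j) \<in> borel_measurable ?P" if "j \<in> J" for j
    using measurable_component_singleton[OF that, of "\<lambda>_. lborel :: real measure"] by simp
  have [measurable]: "(\<lambda>x. \<lambda>j\<in>J. u j \<bullet> x) \<in> measurable borel ?P"
    by (intro measurable_restrict) simp
  define h where "h y = H (\<lambda>j\<in>J. (y $ e j) / sqrt (s (\<lambda>j\<in>J. y $ e j) + (\<Sum>i\<in>-(e ` J). (y $ i)^2))) *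
      indicator {..<1} (s (\<lambda>j\<in>J. y $ e j) + (\<Sum>i\<in>-(e ` J). (y $ i)^2))" for y :: "real^'n::_"
  have [measurable]: "(\<lambda>y :: real^'n::_. y $ i) \<in> borel_measurable borel" for i
    by (intro borel_measurable_continuous_onI continuous_intros)
  have [measurable]: "(\<lambda>y :: real^'n::_. s (\<lambda>j\<in>J. y $ e j)) \<in> borel_measurable borel"
    by (rule measurable_compose[OF _ s_meas]) (intro measurable_restrict, simp)
  have h[measurable]: "h \<in> borel_measurable borel"
  proof -
    have [measurable]: "(\<lambda>y::real^'n::_. \<lambda>j\<in>J. (y $ e j) / sqrt (s (\<lambda>j\<in>J. y $ e j) + (\<Sum>i\<in>-(e ` J). (y $ i)^2)))
        \<in> measurable borel ?P"
      by (intro measurable_restrict) simp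
    show ?thesis unfolding h_def by measurable
  qed
  have hA: "H (\<lambda>j\<in>J. u j \<bullet> sgn x) * indicator (ball 0 1) x = h (A *v x)" for x
  proof -
    have *: "s (\<lambda>j\<in>J. (A *v x) $ e j) + (\<Sum>i\<in>-(e ` J). ((A *v x) $ i)^2) = x \<bullet> x"
      unfolding norm_eq by (simp add: Au cong: restrict_cong)
    have "(\<lambda>j\<in>J. u j \<bullet> sgn x) = (\<lambda>j\<in>J. (A *v x) $ e j / sqrt (x \<bullet> x))"
      by (auto simp: Au sgn_div_norm norm_eq_sqrt_inner divide_inverse mult.commute)
    moreover have "x \<in> ball 0 1 \<longleftrightarrow> x \<bullet> x \<in> {..<1}"
      using real_sqrt_less_iff[of "x \<bullet> x" 1] by (simp add: norm_eq_sqrt_inner)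
    ultimately show ?thesis unfolding h_def * by (simp add: indicator_def)
  qed
  define \<phi> where "\<phi> c q = H (\<lambda>j\<in>J. c j / sqrt q) * indicator {..<1} q" for c q
  have \<phi>[measurable]: "(\<lambda>p. \<phi> (fst p) (snd p)) \<in> borel_measurable (?P \<Otimes>\<^sub>M borel)"
  proof -
    have [measurable]: "(\<lambda>p. \<lambda>j\<in>J. fst p j / sqrt (snd p)) \<in> measurable (?P \<Otimes>\<^sub>M borel) ?P"
      by (intro measurable_restrict) simp
    show ?thesis unfolding \<phi>_def by measurable
  qed
  have \<phi>c[measurable]: "\<phi> c \<in> borel_measurable borel" if "c \<in> space ?P" for c
    using measurable_compose[OF measurable_Pair1'[OF that] \<phi>] by simp
  have "(\<integral>\<^sup>+ y. h y \<partial>lborel) = (\<integral>\<^sup>+ c. \<integral>\<^sup>+ z. \<phi> c (s c + (\<Sum>i\<in>-(e ` J). (z i)\<^sup>2)) \<partial>?Z \<partial>?P)"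
  proof -
    let ?f = "\<lambda>(c, z). \<chi> i. if i \<in> e ` J then c (inv_into J e i) else z i"
    have "?f \<in> borel_measurable (?P \<Otimes>\<^sub>M ?Z)"
      by (rule split_coordinates_measurable[OF J(1,2)])
    then have "(\<integral>\<^sup>+ y. h y \<partial>lborel) = (\<integral>\<^sup>+ p. h (?f p) \<partial>(?P \<Otimes>\<^sub>M ?Z))"
      by (subst lborel_split_coordinates[OF J(1,2)]) (simp add: nn_integral_distr)
    also have "\<dots> = (\<integral>\<^sup>+ p. \<phi> (fst p) (s (fst p) + (\<Sum>i\<in>-(e ` J). (snd p i)\<^sup>2)) \<partial>(?P \<Otimes>\<^sub>M ?Z))"
    proof (rule nn_integral_cong)
      fix p assume p: "p \<in> space (?P \<Otimes>\<^sub>M ?Z)"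
      have "(\<lambda>j\<in>J. ?f p $ e j) = fst p"
        using p J(2) by (auto simp: split_beta space_pair_measure space_PiM PiE_def extensional_def)
      then have "(\<lambda>j\<in>J. ?f p $ e j) = fst p" "j \<in> J \<Longrightarrow> ?f p $ e j = fst p j" for j
        by (auto dest: fun_cong[of _ _ j])
      moreover have "(\<Sum>i\<in>-(e ` J). (?f p $ i)\<^sup>2) = (\<Sum>i\<in>-(e ` J). (snd p i)\<^sup>2)"
        by (rule sum.cong) (auto simp: split_beta)
      ultimately show "h (?f p) = \<phi> (fst p) (s (fst p) + (\<Sum>i\<in>-(e ` J). (snd p i)\<^sup>2))"
        unfolding h_def \<phi>_def by (simp cong: restrict_cong)
    qed
    also have "\<dots> = (\<integral>\<^sup>+ c. \<integral>\<^sup>+ z. \<phi> c (s c + (\<Sum>i\<in>-(e ` J). (z i)\<^sup>2)) \<partial>?Z \<partial>?P)"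
    proof -
      have "(\<lambda>p. (fst p, s (fst p) + (\<Sum>i\<in>-(e ` J). (snd p i)\<^sup>2))) \<in> measurable (?P \<Otimes>\<^sub>M ?Z) (?P \<Otimes>\<^sub>M borel)"
        by measurable
      from measurable_compose[OF this \<phi>]
      have "(\<lambda>p. \<phi> (fst p) (s (fst p) + (\<Sum>i\<in>-(e ` J). (snd p i)\<^sup>2))) \<in> borel_measurable (?P \<Otimes>\<^sub>M ?Z)"
        by simp
      from Z.nn_integral_fst[OF this] show ?thesis by simp
    qed
    finally show ?thesis .
  qed
  also have "\<dots> = (\<integral>\<^sup>+ c. \<integral>\<^sup>+ q. \<phi> c q * (ennreal (\<omega> * (q - s c) powr a) * indicator {s c<..} q) \<partial>lborel \<partial>?P)"
  proof (rule nn_integral_cong)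
    fix c assume c: "c \<in> space ?P"
    note [measurable] = \<phi>c[OF c]
    have "(\<integral>\<^sup>+ z. \<phi> c (s c + (\<Sum>i\<in>-(e ` J). (z i)\<^sup>2)) \<partial>?Z) =
        (\<integral>\<^sup>+ t. \<phi> c (s c + t) \<partial>distr ?Z borel (\<lambda>z. \<Sum>i\<in>-(e ` J). (z i)\<^sup>2))"
      using sumsq by (subst nn_integral_distr) (auto simp del: borel_measurable_sum)
    also have "\<dots> = (\<integral>\<^sup>+ t. ennreal (\<omega> * t powr a) * indicator {0<..} t * \<phi> c (s c + t) \<partial>lborel)"
      unfolding distr_sum_squares_PiM_lborel[OF finite neZ] cardZ \<omega>_def a_def
      by (subst nn_integral_density) auto
    also have "\<dots> = (\<integral>\<^sup>+ q. ennreal (\<omega> * (- s c + 1 * q) powr a) * indicator {0<..} (- s c + 1 * q) * \<phi> c (s c + (- s c + 1 * q)) \<partial>lborel)"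
      by (subst nn_integral_real_affine[where c = 1 and t = "- s c"]) auto
    also have "\<dots> = (\<integral>\<^sup>+ q. \<phi> c q * (ennreal (\<omega> * (q - s c) powr a) * indicator {s c<..} q) \<partial>lborel)"
      by (intro nn_integral_cong) (auto simp: mult.commute split: split_indicator)
    finally show "(\<integral>\<^sup>+ z. \<phi> c (s c + (\<Sum>i\<in>-(e ` J). (z i)\<^sup>2)) \<partial>?Z) =
        (\<integral>\<^sup>+ q. \<phi> c q * (ennreal (\<omega> * (q - s c) powr a) * indicator {s c<..} q) \<partial>lborel)" .
  qed
  also have "\<dots> = (\<integral>\<^sup>+ q. \<integral>\<^sup>+ c. \<phi> c q * (ennreal (\<omega> * (q - s c) powr a) * indicator {s c<..} q) \<partial>?P \<partial>lborel)"
  proof (rule PL.Fubini'[symmetric])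
    have "{p \<in> space (?P \<Otimes>\<^sub>M lborel). s (fst p) < snd p} \<in> sets (?P \<Otimes>\<^sub>M lborel)" by measurable
    then have [measurable]: "(\<lambda>p. indicator {s (fst p)<..} (snd p) :: ennreal) \<in> borel_measurable (?P \<Otimes>\<^sub>M lborel)"
      unfolding indicator_def by (simp)
    show "(\<lambda>(c, q). \<phi> c q * (ennreal (\<omega> * (q - s c) powr a) * indicator {s c<..} q)) \<in> borel_measurable (?P \<Otimes>\<^sub>M lborel)"
      using \<phi> unfolding split_beta' by measurable
  qed
  also have "\<dots> = (\<integral>\<^sup>+ q. ennreal (\<omega> * q powr (n / 2 - 1)) * indicator {0<..<1} q *
      (\<integral>\<^sup>+ c. ennreal (max 0 (1 - s c) powr a) * H c \<partial>?P) \<partial>lborel)"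
  proof (rule nn_integral_cong)
    fix q :: real
    show "(\<integral>\<^sup>+ c. \<phi> c q * (ennreal (\<omega> * (q - s c) powr a) * indicator {s c<..} q) \<partial>?P) =
      ennreal (\<omega> * q powr (n / 2 - 1)) * indicator {0<..<1} q * (\<integral>\<^sup>+ c. ennreal (max 0 (1 - s c) powr a) * H c \<partial>?P)"
    proof (cases "0 < q \<and> q < 1")
      case False
      have z: "\<phi> c q * (ennreal (\<omega> * (q - s c) powr a) * indicator {s c<..} q) = 0" for c
        using False s_nonneg[of c] by (auto simp: \<phi>_def split: split_indicator)
      have ind: "indicator {0<..<1} q = (0::ennreal)" using False by simp
      show ?thesis unfolding z ind by simp
    next
      case True
      define r where "r = sqrt q"
      have r: "r > 0" "r^2 = q" using True by (auto simp: r_def)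
      have \<phi>q: "(\<lambda>c. \<phi> c q) \<in> borel_measurable ?P"
        using measurable_compose[OF measurable_Pair2'[of q borel ?P] \<phi>] by simp
      have [measurable]: "(\<lambda>c. indicator {s c<..} q :: ennreal) \<in> borel_measurable ?P"
        unfolding indicator_def by simp
      have "(\<integral>\<^sup>+ c. \<phi> c q * (ennreal (\<omega> * (q - s c) powr a) * indicator {s c<..} q) \<partial>?P) =
        ennreal (r ^ m) * (\<integral>\<^sup>+ c. \<phi> (\<lambda>j\<in>J. r * c j) q * (ennreal (\<omega> * (q - s (\<lambda>j\<in>J. r * c j)) powr a) *
            indicator {s (\<lambda>j\<in>J. r * c j)<..} q) \<partial>?P)"
        unfolding m_def using \<phi>q by (subst PiM_lborel_scale[OF J(1) r(1)]) auto
      also have "(\<integral>\<^sup>+ c. \<phi> (\<lambda>j\<in>J. r * c j) q * (ennreal (\<omega> * (q - s (\<lambda>j\<in>J. r * c j)) powr a) *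
            indicator {s (\<lambda>j\<in>J. r * c j)<..} q) \<partial>?P) =
          (\<integral>\<^sup>+ c. ennreal (\<omega> * q powr a) * (ennreal (max 0 (1 - s c) powr a) * H c) \<partial>?P)"
      proof (rule nn_integral_cong)
        fix c assume c: "c \<in> space ?P"
        have "(\<lambda>j\<in>J. (\<lambda>j\<in>J. r * c j) j / sqrt q) = c"
          using c r(1) by (auto simp: r_def[symmetric] space_PiM PiE_def extensional_def)
        then have 1: "\<phi> (\<lambda>j\<in>J. r * c j) q = H c" using True by (simp add: \<phi>_def)
        have 2: "q - s (\<lambda>j\<in>J. r * c j) = q * (1 - s c)" by (simp add: s_scale r(2) algebra_simps)
        have 3: "indicator {s (\<lambda>j\<in>J. r * c j)<..} q = (indicator {..<1} (s c) :: ennreal)"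
          using True by (simp add: s_scale r(2) indicator_def)
        show "\<phi> (\<lambda>j\<in>J. r * c j) q * (ennreal (\<omega> * (q - s (\<lambda>j\<in>J. r * c j)) powr a) *
            indicator {s (\<lambda>j\<in>J. r * c j)<..} q) = ennreal (\<omega> * q powr a) * (ennreal (max 0 (1 - s c) powr a) * H c)"
        proof (cases "s c < 1")
          case less: True
          have "(q * (1 - s c)) powr a = q powr a * (1 - s c) powr a"
            using True less by (simp add: powr_mult)
          then show ?thesis unfolding 1 2 3 using less \<omega>pos
            by (simp add: ennreal_mult' mult_ac)
        qed (simp add: 1 3)
      qed
      also have "\<dots> = ennreal (\<omega> * q powr a) * (\<integral>\<^sup>+ c. ennreal (max 0 (1 - s c) powr a) * H c \<partial>?P)"
        by (intro nn_integral_cmult) measurable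
      also have "ennreal (r ^ m) * \<dots> = ennreal (\<omega> * (r ^ m * q powr a)) * (\<integral>\<^sup>+ c. ennreal (max 0 (1 - s c) powr a) * H c \<partial>?P)"
        using r(1) \<omega>pos by (simp add: ennreal_mult' mult_ac)
      also have "r ^ m * q powr a = q powr (n / 2 - 1)"
      proof -
        have "r ^ m = q powr (real m / 2)"
          using True by (simp add: r_def powr_half_sqrt[symmetric] powr_powr flip: powr_realpow)
        then show ?thesis using True by (simp add: a_def d m_def field_simps flip: powr_add)
      qed
      finally show ?thesis using True by simp
    qed
  qed
  also have "\<dots> = ennreal (\<omega> * (2 / n)) * (\<integral>\<^sup>+ c. ennreal (max 0 (1 - s c) powr a) * H c \<partial>?P)"
  proof -
    have "(\<integral>\<^sup>+ q. ennreal (\<omega> * q powr (n / 2 - 1)) * indicator {0<..<1} q \<partial>lborel) =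
        (\<integral>\<^sup>+ q. ennreal \<omega> * (ennreal (q powr (n / 2 - 1)) * indicator {0<..<1} q) \<partial>lborel)"
      using \<omega>pos by (intro nn_integral_cong) (simp add: ennreal_mult' mult.assoc)
    also have "\<dots> = ennreal (\<omega> * (2 / n))"
      using nn_integral_powr_0_1[of "n / 2"] npos by (simp add: nn_integral_cmult ennreal_mult'[OF \<omega>pos, symmetric])
    finally show ?thesis by (simp add: nn_integral_multc)
  qed
  finally have int_h: "(\<integral>\<^sup>+ y. h y \<partial>lborel) = \<dots>" .
  have ball: "emeasure lborel (ball (0::real^'n::_) 1) = ennreal (unit_ball_vol n)"
    by (simp add: emeasure_ball n_def)
  have Vpos: "unit_ball_vol n > 0" using npos by simp
  have "(\<integral>\<^sup>+ w. H (\<lambda>j\<in>J. u j \<bullet> w) \<partial>uniform_sphere) = (\<integral>\<^sup>+ x. h (A *v x) \<partial>lborel) / ennreal (unit_ball_vol n)"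
    by (subst nn_integral_uniform_sphere) (simp_all add: hA ball)
  also have "\<dots> = ennreal (1 / \<bar>det A\<bar>) * (ennreal (\<omega> * (2 / n)) * (\<integral>\<^sup>+ c. ennreal (max 0 (1 - s c) powr a) * H c \<partial>?P)) / ennreal (unit_ball_vol n)"
    by (simp add: nn_integral_linear_image[OF det h] int_h)
  also have "\<dots> = ennreal (\<omega> * (2 / n) / unit_ball_vol n / \<bar>det A\<bar>) * (\<integral>\<^sup>+ c. ennreal (max 0 (1 - s c) powr a) * H c \<partial>?P)"
    using Vpos \<omega>pos npos by (simp add: divide_ennreal_def inverse_ennreal ennreal_mult' divide_inverse mult_ac)
  also have "\<omega> * (2 / n) / unit_ball_vol n = Gamma (n / 2) / (pi powr (real m / 2) * Gamma (d / 2))"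
  proof -
    have "\<omega> * (2 / n) / unit_ball_vol n = \<omega> / (unit_ball_vol n * (n / 2))" by simp
    also have "\<dots> = pi powr (d / 2) / Gamma (d / 2) / (pi powr (n / 2) / Gamma (n / 2))"
      unfolding \<omega>_def using unit_ball_vol_Gamma[OF dpos] unit_ball_vol_Gamma[OF npos] by simp
    also have "pi powr (n / 2) = pi powr (d / 2) * pi powr (real m / 2)"
      by (simp add: d m_def flip: powr_add add_divide_distrib)
    finally show ?thesis by simp
  qed
  finally show ?thesis unfolding m_def a_def .
qed

section \<open>The density of correlation matrices\<close>

definition pairs :: "'k::linorder set \<Rightarrow> ('k \<times> 'k) set" where
  "pairs K = {(i, j). i \<in> K \<and> j \<in> K \<and> i < j}"

text \<open>
  Rows and columns outside \<open>K\<close> are those of the identity matrix, which changes neither the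
  determinant nor positive semidefiniteness.
\<close>

definition corr_mat :: "'k::{finite,wellorder} set \<Rightarrow> ('k \<times> 'k \<Rightarrow> real) \<Rightarrow> real^'k::_^'k::_" where
  "corr_mat K x = matrix_of_above_diag (\<lambda>p. if p \<in> pairs K then x p else 0)"

definition inner_pairs :: "'k::linorder set \<Rightarrow> ('k \<Rightarrow> 'a::real_inner) \<Rightarrow> ('k \<times> 'k \<Rightarrow> real)" where
  "inner_pairs K v = (\<lambda>p\<in>pairs K. v (fst p) \<bullet> v (snd p))"

text \<open>
  The dimension \<open>n\<close> and the number \<open>m\<close> of vectors are parameters, and the matrix may have more
  than \<open>m\<close> rows: it is then padded by an identity. A singular matrix has density \<open>0 powr _ = 0\<close>.
\<close>

definition corr_density :: "real \<Rightarrow> nat \<Rightarrow> real^'k^'k \<Rightarrow> ennreal" where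
  "corr_density n m A = (if A \<in> psd_unit_diag
     then ennreal (det A powr ((n - real m - 1) / 2) * Gamma (n / 2) ^ m * inverse (multivariate_Gamma m (n / 2)))
     else 0)"

lemma finite_pairs [simp]: "finite (pairs K)" for K :: "'k::{finite,linorder} set"
  by (rule finite_subset[of _ UNIV]) auto

lemma corr_mat_nth:
  "corr_mat K x $ i $ j = (if i = j then 1 else if i \<in> K \<and> j \<in> K then (if i < j then x (i, j) else x (j, i)) else 0)"
  by (auto simp: corr_mat_def matrix_of_above_diag_def pairs_def)

lemma transpose_corr_mat: "transpose (corr_mat K x) = corr_mat K x"
  by (auto simp: vec_eq_iff transpose_def corr_mat_nth)

lemma corr_mat_in_psd_unit_diag_iff: "corr_mat K x \<in> psd_unit_diag \<longleftrightarrow> pos_semidef (corr_mat K x)"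
  by (simp add: psd_unit_diag_def corr_mat_nth)

lemma corr_mat_merge:
  assumes "\<forall>a\<in>K. a < b"
  shows "corr_mat (insert b K) (merge (pairs K) (K \<times> {b}) (x, c)) =
           border (corr_mat K x) b (\<chi> i. if i \<in> K then c (i, b) else 0)"
  using assms unfolding vec_eq_iff
  by (auto simp: corr_mat_nth border_def merge_def pairs_def)

lemma pairs_insert:
  assumes "\<forall>a\<in>K. a < b"
  shows "pairs (insert b K) = pairs K \<union> K \<times> {b}" "pairs K \<inter> K \<times> {b} = {}"
  using assms by (auto simp: pairs_def)

lemma inner_pairs_insert:
  assumes "\<forall>a\<in>K. a < b"
  shows "inner_pairs (insert b K) (v(b := w)) =
    merge (pairs K) (K \<times> {b}) (inner_pairs K v, \<lambda>p\<in>K \<times> {b}. v (fst p) \<bullet> w)"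
proof
  fix p
  show "inner_pairs (insert b K) (v(b := w)) p =
    merge (pairs K) (K \<times> {b}) (inner_pairs K v, \<lambda>p\<in>K \<times> {b}. v (fst p) \<bullet> w) p"
    using assms by (cases p) (auto simp: inner_pairs_def merge_def pairs_def)
qed

lemma bordered_corr_mat:
  assumes "\<forall>a\<in>K. a < b"
  shows "bordered (corr_mat K x) b (\<chi> i. if i \<in> K then c (i, b) else 0)"
  using assms by unfold_locales (auto simp: transpose_corr_mat corr_mat_nth)

lemma closed_psd_unit_diag: "closed (psd_unit_diag :: (real^'k^'k) set)"
proof -
  have "psd_unit_diag = {A :: real^'k^'k. (\<forall>i j. A $ i $ j = A $ j $ i) \<and>
      (\<forall>x. 0 \<le> (\<Sum>i\<in>UNIV. x $ i * (\<Sum>j\<in>UNIV. A $ i $ j * x $ j))) \<and> (\<forall>i. A $ i $ i = 1)}"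
    by (auto simp: psd_unit_diag_def pos_semidef_def vec_eq_iff transpose_def inner_vec_def matrix_vector_mult_def)
  also have "closed \<dots>"
    by (intro closed_Collect_conj closed_Collect_all closed_Collect_eq closed_Collect_le continuous_intros)
  finally show ?thesis .
qed

lemma borel_measurable_det [measurable]: "(det :: real^'k^'k \<Rightarrow> real) \<in> borel_measurable borel"
  unfolding det_def[abs_def]
  by (intro borel_measurable_continuous_onI continuous_intros)

lemma corr_density_measurable [measurable]: "corr_density n m \<in> borel_measurable (borel :: (real^'k^'k) measure)"
proof -
  have [measurable]: "(psd_unit_diag :: (real^'k^'k) set) \<in> sets borel"
    using closed_psd_unit_diag by (rule borel_closed)
  show ?thesis unfolding corr_density_def[abs_def] by measurable
qed

text \<open>
  The map that fills a matrix is measurable on the product over all pairs above the diagonal, so \<open>x\<close>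
  is first extended to them by zero.
\<close>

lemma corr_mat_measurable [measurable]:
  "corr_mat K \<in> borel_measurable (\<Pi>\<^sub>M p\<in>pairs K. lborel)" for K :: "'k::{finite,wellorder} set"
proof -
  have "(\<lambda>x. \<lambda>p\<in>above_diag. if p \<in> pairs K then x p else 0) \<in>
      measurable (\<Pi>\<^sub>M p\<in>pairs K. lborel :: real measure) (\<Pi>\<^sub>M p\<in>above_diag. lborel)"
  proof (rule measurable_restrict)
    fix p :: "'k \<times> 'k"
    show "(\<lambda>x. if p \<in> pairs K then x p else 0) \<in> measurable (\<Pi>\<^sub>M p\<in>pairs K. lborel :: real measure) lborel"
      by (cases "p \<in> pairs K") (auto intro: measurable_component_singleton)
  qed
  from measurable_compose[OF this matrix_of_above_diag_measurable]
  have "(\<lambda>x. matrix_of_above_diag (\<lambda>p\<in>above_diag. if p \<in> pairs K then x p else 0)) \<in>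
      measurable (\<Pi>\<^sub>M p\<in>pairs K. lborel :: real measure) (restrict_space borel sym_unit_diag)" .
  from measurable_restrict_space2_iff[THEN iffD1, OF this]
  have "(\<lambda>x. matrix_of_above_diag (\<lambda>p\<in>above_diag. if p \<in> pairs K then x p else 0)) \<in>
      borel_measurable (\<Pi>\<^sub>M p\<in>pairs K. lborel :: real measure)" by blast
  also have "(\<lambda>x. matrix_of_above_diag (\<lambda>p\<in>above_diag. if p \<in> pairs K then x p else 0)) = corr_mat K"
    by (auto simp: fun_eq_iff corr_mat_def matrix_of_above_diag_def vec_eq_iff above_diag_def)
  finally show ?thesis .
qed

lemma multivariate_Gamma_Suc:
  "multivariate_Gamma (Suc m) a = multivariate_Gamma m a * (pi powr (real m / 2) * Gamma (a - real m / 2))"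
proof -
  have "real (Suc m) * (real (Suc m) - 1) / 4 = real m * (real m - 1) / 4 + real m / 2"
    by (simp add: field_simps)
  then have "pi powr (real (Suc m) * (real (Suc m) - 1) / 4) = pi powr (real m * (real m - 1) / 4) * pi powr (real m / 2)"
    by (simp only: powr_add)
  then show ?thesis by (simp add: multivariate_Gamma_def)
qed

lemma multivariate_Gamma_pos:
  assumes "real m \<le> n"
  shows "multivariate_Gamma m (n / 2) > 0"
  unfolding multivariate_Gamma_def
proof (intro mult_pos_pos prod_pos ballI Gamma_real_pos)
  fix j assume "j \<in> {1..m}"
  then have "real j \<le> real m" by simp
  then show "0 < n / 2 - (real j - 1) / 2" using assms by simp
qed simp

lemma corr_density_nz_iff:
  assumes "real m \<le> n" "n > 0"
  shows "corr_density n m A \<noteq> 0 \<longleftrightarrow> A \<in> psd_unit_diag \<and> det A \<noteq> 0"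
  using multivariate_Gamma_pos[OF assms(1)] assms(2)
  by (auto simp: corr_density_def ennreal_eq_0_iff mult_le_0_iff not_le zero_less_mult_iff)

lemma corr_density_finite: "corr_density n m A \<noteq> top"
  by (simp add: corr_density_def)

text \<open>
  The density of the bordered matrix is that of the old one times the conditional density of the new
  column. By the Schur complement formula the power of \<open>det M\<close> drops by one half, which is the
  Jacobian factor \<open>1 / |D|\<close>, and \<open>1 - s\<close> appears with the exponent of the conditional density.
  If \<open>s > 1\<close>, the bordered matrix is not positive semidefinite and both sides vanish.
\<close>

lemma corr_density_border:
  assumes b: "bordered M b c" and Mp: "M \<in> psd_unit_diag" "det M = D^2" "D \<noteq> 0"
    and m: "real m < n"
    and Bp: "border M b c \<in> psd_unit_diag \<longleftrightarrow> pos_semidef (border M b c)"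
  shows "corr_density n (Suc m) (border M b c) =
    ennreal (Gamma (n / 2) / (pi powr (real m / 2) * Gamma ((n - real m) / 2)) / \<bar>D\<bar>
       * max 0 (1 - c \<bullet> (matrix_inv M *v c)) powr ((n - real m) / 2 - 1)) * corr_density n m M"
proof -
  interpret bordered M b c by fact
  define s where "s = c \<bullet> (matrix_inv M *v c)"
  define e where "e = (n - real m) / 2 - 1"
  define C where "C = Gamma (n / 2) / (pi powr (real m / 2) * Gamma ((n - real m) / 2))"
  have det: "det M \<noteq> 0" using Mp by simp
  have psd: "pos_semidef M" using Mp by (simp add: psd_unit_diag_def)
  have C: "C \<ge> 0" using m by (auto simp: C_def intro!: divide_nonneg_nonneg mult_nonneg_nonneg Gamma_real_nonneg)
  have B: "border M b c \<in> psd_unit_diag \<longleftrightarrow> s \<le> 1"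
    unfolding Bp s_def by (rule pos_semidef_border_iff[OF det psd])
  show ?thesis
  proof (cases "s \<le> 1")
    case False
    then show ?thesis using B by (simp add: corr_density_def s_def[symmetric])
  next
    case True
    have 1: "det (border M b c) powr e = max 0 (1 - s) powr e * (D^2) powr e"
      using True by (simp add: det_border[OF det] s_def[symmetric] Mp powr_mult)
    have 2: "(D^2) powr ((n - real m - 1) / 2) = \<bar>D\<bar> * (D^2) powr e"
    proof -
      have "\<bar>D\<bar> = (D^2) powr (1/2)" by (simp add: powr_half_sqrt)
      moreover have "(n - real m - 1) / 2 = 1/2 + e" by (simp add: e_def field_simps)
      ultimately show ?thesis by (simp only: powr_add)
    qed
    have 3: "inverse (multivariate_Gamma (Suc m) (n / 2)) * Gamma (n / 2) = C * inverse (multivariate_Gamma m (n / 2))"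
      by (simp add: multivariate_Gamma_Suc C_def field_simps)
    have 4: "(n - real (Suc m) - 1) / 2 = e" by (simp add: e_def field_simps)
    have "det (border M b c) powr e * Gamma (n / 2) ^ Suc m * inverse (multivariate_Gamma (Suc m) (n / 2)) =
        det (border M b c) powr e * Gamma (n / 2) ^ m * (inverse (multivariate_Gamma (Suc m) (n / 2)) * Gamma (n / 2))"
      by simp
    also have "\<dots> = C / \<bar>D\<bar> * max 0 (1 - s) powr e * ((D^2) powr ((n - real m - 1) / 2) * Gamma (n / 2) ^ m * inverse (multivariate_Gamma m (n / 2)))"
      unfolding 1 2 3 using Mp(3) by simp
    finally have 5: "det (border M b c) powr e * Gamma (n / 2) ^ Suc m * inverse (multivariate_Gamma (Suc m) (n / 2)) = \<dots>" .
    show ?thesis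
      unfolding corr_density_def s_def[symmetric] e_def[symmetric] C_def[symmetric] 4 5
      using B True Mp C by (simp only: if_True) (subst ennreal_mult', auto)
  qed
qed

lemma inner_pairs_measurable [measurable]:
  fixes K :: "'k::{finite,wellorder} set"
  shows "inner_pairs K \<in> measurable (\<Pi>\<^sub>M i\<in>K. (uniform_sphere :: (real^'n) measure)) (\<Pi>\<^sub>M p\<in>pairs K. lborel)"
  unfolding inner_pairs_def[abs_def]
proof (rule measurable_restrict)
  fix p assume p: "p \<in> pairs K"
  have *: "(\<lambda>v. v i) \<in> borel_measurable (\<Pi>\<^sub>M i\<in>K. (uniform_sphere :: (real^'n) measure))" if "i \<in> K" for i
  proof -
    have "(\<lambda>x. x) \<in> measurable (uniform_sphere :: (real^'n) measure) borel"
      unfolding measurable_cong_sets[OF sets_uniform_sphere refl]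
      by (intro measurable_restrict_space1) simp
    from measurable_compose[OF measurable_component_singleton[OF that] this] show ?thesis .
  qed
  show "(\<lambda>v. v (fst p) \<bullet> v (snd p)) \<in> measurable (\<Pi>\<^sub>M i\<in>K. (uniform_sphere :: (real^'n) measure)) lborel"
    using p by (auto simp: pairs_def intro!: borel_measurable_inner *)
qed

section \<open>Induction over the number of vectors\<close>

text \<open>
  The new column, padded by zeros. Its entries are indexed by pairs since they become entries of
  the enlarged matrix.
\<close>

definition border_vec :: "'k set \<Rightarrow> 'k \<Rightarrow> ('k \<times> 'k \<Rightarrow> real) \<Rightarrow> real^'k" where
  "border_vec K b c = (\<chi> i. if i \<in> K then c (i, b) else 0)"

lemma border_vec_scale: "border_vec K b (\<lambda>p\<in>K \<times> {b}. r * c p) = r *\<^sub>R border_vec K b c"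
  by (auto simp: border_vec_def vec_eq_iff)

text \<open>
  The conditional law of the column of inner products of a new uniform vector with given linearly
  independent unit vectors. It depends on these only through their Gram matrix, which makes the
  induction over the number of vectors possible. With the density of the given Gram matrix multiplied
  in, the matrix inverse gives way to densities that are visibly measurable in the given vectors.
\<close>

lemma conditional_inner_products:
  fixes v :: "'k::{finite,wellorder} \<Rightarrow> real^'n::{finite,wellorder}"
  defines "n \<equiv> real CARD('n)"
  assumes le: "CARD('k) \<le> CARD('n)" and b: "\<forall>a\<in>K. a < b"
    and norm: "\<And>i. i \<in> K \<Longrightarrow> norm (v i) = 1"
    and x: "x = inner_pairs K v"
    and nz: "corr_density n (card K) (corr_mat K x) \<noteq> 0"
    and H[measurable]: "H \<in> borel_measurable (\<Pi>\<^sub>M p\<in>K \<times> {b}. lborel)"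
  shows "(\<integral>\<^sup>+ w. H (\<lambda>p\<in>K \<times> {b}. v (fst p) \<bullet> w) \<partial>uniform_sphere) * corr_density n (card K) (corr_mat K x) =
    (\<integral>\<^sup>+ c. corr_density n (Suc (card K)) (border (corr_mat K x) b (border_vec K b c)) * H c
       \<partial>(\<Pi>\<^sub>M p\<in>K \<times> {b}. lborel))"
proof -
  let ?J = "K \<times> {b}"
  let ?P = "\<Pi>\<^sub>M p\<in>?J. lborel :: real measure"
  define M where "M = corr_mat K x"
  have bK: "b \<notin> K" using b by auto
  have cardK: "card K < CARD('k)" using bK by (intro psubset_card_mono) auto
  have m: "real (card K) < n" using cardK le by (simp add: n_def)
  then have npos: "n > 0" by linarith
  have M_psd: "M \<in> psd_unit_diag" and detM: "det M \<noteq> 0"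
    using nz corr_density_nz_iff[of "card K" n "corr_mat K x"] m npos by (auto simp: M_def)
  have psd: "pos_semidef M" using M_psd by (simp add: psd_unit_diag_def)
  obtain e :: "'k \<Rightarrow> 'n" where e: "inj e"
    using card_le_inj[of "UNIV :: 'k set" "UNIV :: 'n set"] le by auto
  have G: "M = (\<chi> i j. if i \<in> K \<and> j \<in> K then v i \<bullet> v j else if i = j then 1 else 0)"
  proof -
    have "M $ i $ j = (if i \<in> K \<and> j \<in> K then v i \<bullet> v j else if i = j then 1 else 0)" for i j
    proof (cases i j rule: linorder_cases)
      case less
      then show ?thesis by (simp add: M_def corr_mat_nth x inner_pairs_def pairs_def)
    next
      case equal
      then show ?thesis using norm[unfolded norm_eq_1, of j] by (auto simp: M_def corr_mat_nth)
    next
      case greater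
      then show ?thesis
        by (auto simp: M_def corr_mat_nth x inner_pairs_def pairs_def inner_commute[of "v j" "v i"])
    qed
    then show ?thesis by (simp add: vec_eq_iff)
  qed
  obtain A :: "real^'n::_^'n::_"
    where A: "\<forall>i\<in>K. \<forall>x. (A *v x) $ e i = v i \<bullet> x" and detA: "(det A)\<^sup>2 = det M"
      and "\<forall>x c. c = (\<chi> i. if i \<in> K then v i \<bullet> x else 0) \<longrightarrow>
           x \<bullet> x = c \<bullet> (matrix_inv M *v c) + (\<Sum>j\<in>-(e ` K). ((A *v x) $ j)^2)"
    by (rule Gram_coordinates[OF e detM G])
  then have norm_eq: "c = (\<chi> i. if i \<in> K then v i \<bullet> y else 0) \<Longrightarrow>
      y \<bullet> y = c \<bullet> (matrix_inv M *v c) + (\<Sum>j\<in>-(e ` K). ((A *v y) $ j)^2)" for y c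
    by blast
  have detA_nz: "det A \<noteq> 0" using detA detM by auto
  define s where "s c = border_vec K b c \<bullet> (matrix_inv M *v border_vec K b c)" for c
  have bord: "bordered M b (border_vec K b c)" for c
    unfolding M_def border_vec_def by (rule bordered_corr_mat[OF b])
  have s_meas: "s \<in> borel_measurable ?P"
  proof -
    have [measurable]: "(\<lambda>c. border_vec K b c $ i) \<in> borel_measurable ?P" for i
      by (cases "i \<in> K") (auto simp: border_vec_def intro!: measurable_component_singleton[of _ _ "\<lambda>_. lborel", simplified])
    show ?thesis unfolding s_def inner_vec_def matrix_vector_mult_def by simp measurable
  qed
  have s_nonneg: "0 \<le> s c" for c
  proof -
    define a where "a = matrix_inv M *v border_vec K b c"
    have "M *v a = border_vec K b c"
      unfolding a_def by (rule bordered.M_a[OF bord detM])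
    moreover have "0 \<le> a \<bullet> (M *v a)" using psd by (simp add: pos_semidef_def)
    ultimately show ?thesis by (simp add: s_def a_def inner_commute)
  qed
  have s_scale: "s (\<lambda>p\<in>?J. r * c p) = r^2 * s c" for r c
    by (simp add: s_def border_vec_scale matrix_vector_mult_scaleR power2_eq_square)
  define d where "d = n - real (card K)"
  have cardJ: "card ?J = card K" by (simp add: card_cartesian_product)
  have img: "(\<lambda>p. e (fst p)) ` ?J = e ` K" by force
  have "card (e ` K) < CARD('n)" using cardK le e by (simp add: card_image inj_on_subset)
  then have ne: "e ` K \<noteq> UNIV" by auto
  define C where "C = Gamma (n / 2) / (pi powr (real (card K) / 2) * Gamma (d / 2)) / \<bar>det A\<bar>"
  have C: "C \<ge> 0" using m npos by (auto simp: C_def d_def intro!: divide_nonneg_nonneg mult_nonneg_nonneg Gamma_real_nonneg)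
  have "(\<integral>\<^sup>+ w. H (\<lambda>p\<in>?J. v (fst p) \<bullet> w) \<partial>uniform_sphere) =
    ennreal C * (\<integral>\<^sup>+ c. ennreal (max 0 (1 - s c) powr (d / 2 - 1)) * H c \<partial>?P)"
    unfolding C_def cardJ[symmetric] n_def
  proof (rule uniform_sphere_linear_functionals[where e = "\<lambda>p. e (fst p)"])
    show "inj_on (\<lambda>p. e (fst p)) ?J" using e by (auto simp: inj_on_def dest: injD)
    show "(\<lambda>p. e (fst p)) ` ?J \<noteq> UNIV" using ne img by simp
    show "det A \<noteq> 0" by (rule detA_nz)
    show "y \<bullet> y = s (\<lambda>p\<in>?J. v (fst p) \<bullet> y) + (\<Sum>i\<in>-((\<lambda>p. e (fst p)) ` ?J). ((A *v y) $ i)^2)" for y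
      unfolding s_def img by (rule norm_eq) (auto simp: border_vec_def vec_eq_iff)
  qed (use A s_meas s_nonneg s_scale H in \<open>auto simp: d_def cardJ n_def\<close>)
  then have "(\<integral>\<^sup>+ w. H (\<lambda>p\<in>?J. v (fst p) \<bullet> w) \<partial>uniform_sphere) * corr_density n (card K) M =
    (ennreal C * corr_density n (card K) M) * (\<integral>\<^sup>+ c. ennreal (max 0 (1 - s c) powr (d / 2 - 1)) * H c \<partial>?P)"
    by (simp add: mult_ac)
  also have "\<dots> = (\<integral>\<^sup>+ c. (ennreal C * corr_density n (card K) M) * (ennreal (max 0 (1 - s c) powr (d / 2 - 1)) * H c) \<partial>?P)"
    using s_meas by (subst nn_integral_cmult) auto
  also have "\<dots> = (\<integral>\<^sup>+ c. corr_density n (Suc (card K)) (border M b (border_vec K b c)) * H c \<partial>?P)"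
  proof (rule nn_integral_cong)
    fix c
    have "border M b (border_vec K b c) \<in> psd_unit_diag \<longleftrightarrow> pos_semidef (border M b (border_vec K b c))"
      unfolding M_def border_vec_def corr_mat_merge[OF b, symmetric] by (rule corr_mat_in_psd_unit_diag_iff)
    from corr_density_border[OF bord M_psd detA[symmetric] detA_nz m this]
    have "corr_density n (Suc (card K)) (border M b (border_vec K b c)) =
        ennreal (C * max 0 (1 - s c) powr (d / 2 - 1)) * corr_density n (card K) M"
      by (simp only: C_def d_def s_def)
    then show "(ennreal C * corr_density n (card K) M) * (ennreal (max 0 (1 - s c) powr (d / 2 - 1)) * H c) =
        corr_density n (Suc (card K)) (border M b (border_vec K b c)) * H c"
      using C by (simp add: ennreal_mult' mult_ac)
  qed
  finally show ?thesis by (simp add: M_def)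
qed

text \<open>
  Induction over the set of vectors, adding the largest index last, so that the new pairs all have
  the form \<open>(i, b)\<close>. Integrate over the new vector first with the others fixed. The result is a function
  of the old inner products alone and the induction hypothesis applies to it.
\<close>

lemma nn_integral_inner_pairs:
  fixes K :: "'k::{finite,wellorder} set"
  defines "n \<equiv> real CARD('n::{finite,wellorder})"
  assumes le: "CARD('k) \<le> CARD('n)"
    and "F \<in> borel_measurable (\<Pi>\<^sub>M p\<in>pairs K. lborel)"
  shows "(\<integral>\<^sup>+ v. F (inner_pairs K v) \<partial>(\<Pi>\<^sub>M i\<in>K. (uniform_sphere :: (real^'n::_) measure))) =
    (\<integral>\<^sup>+ x. corr_density n (card K) (corr_mat K x) * F x \<partial>(\<Pi>\<^sub>M p\<in>pairs K. lborel))"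
  using finite[of K] assms(3)
proof (induction K arbitrary: F rule: finite_linorder_max_induct)
  case empty
  have "corr_mat {} x = (mat 1 :: real^'k::_^'k::_)" for x
    by (auto simp: vec_eq_iff corr_mat_nth mat_def)
  moreover have "mat 1 \<in> (psd_unit_diag :: (real^'k::_^'k::_) set)"
    by (auto simp: psd_unit_diag_def pos_semidef_def transpose_mat) (simp add: mat_def)
  moreover have "inner_pairs {} v = (\<lambda>_. undefined)" for v :: "'k \<Rightarrow> real^'n::_"
    by (auto simp: inner_pairs_def pairs_def)
  moreover have "pairs {} = ({} :: ('k \<times> 'k) set)" by (auto simp: pairs_def)
  ultimately show ?case
    by (simp add: PiM_empty nn_integral_count_space_finite corr_density_def multivariate_Gamma_def)
next
  case (insert b K)
  let ?S = "uniform_sphere :: (real^'n::_) measure"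
  let ?J = "K \<times> {b}"
  let ?P = "\<Pi>\<^sub>M p\<in>pairs K. lborel :: real measure" and ?Q = "\<Pi>\<^sub>M p\<in>?J. lborel :: real measure"
  let ?f = "\<lambda>x. corr_density n (card K) (corr_mat K x)"
  let ?g = "\<lambda>x. corr_density n (Suc (card K)) (corr_mat (insert b K) x)"
  let ?merge = "\<lambda>x c. merge (pairs K) ?J (x, c)"
  interpret S: product_prob_space "\<lambda>_::'k. ?S"
    by (intro product_prob_spaceI prob_space_uniform_sphere)
  interpret Q: sigma_finite_measure ?Q by (rule lborel_prod.sigma_finite) simp
  have b: "\<forall>a\<in>K. a < b" by fact
  have bK: "b \<notin> K" using b by auto
  have card: "card (insert b K) = Suc (card K)" using bK insert.hyps(1) by simp
  have "card K < CARD('k)" using bK by (intro psubset_card_mono) auto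
  then have m: "real (Suc (card K)) \<le> n" "real (card K) \<le> n" "n > 0" using le by (auto simp: n_def)
  have merge: "merge (pairs K) ?J \<in> measurable (?P \<Otimes>\<^sub>M ?Q) (\<Pi>\<^sub>M p\<in>pairs (insert b K). lborel)"
    unfolding pairs_insert(1)[OF b] by measurable
  note F[measurable] = insert.prems
  have Fm: "(\<lambda>p. F (merge (pairs K) ?J p)) \<in> borel_measurable (?P \<Otimes>\<^sub>M ?Q)"
    by (rule measurable_compose[OF merge F])
  have gm: "(\<lambda>p. ?g (merge (pairs K) ?J p)) \<in> borel_measurable (?P \<Otimes>\<^sub>M ?Q)"
    by (rule measurable_compose[OF merge]) measurable
  define \<Psi> where "\<Psi> x = (\<integral>\<^sup>+ c. ?g (?merge x c) * F (?merge x c) \<partial>?Q)" for x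
  have \<Psi>[measurable]: "\<Psi> \<in> borel_measurable ?P"
  proof -
    have "(\<lambda>(x, c). ?g (?merge x c) * F (?merge x c)) \<in> borel_measurable (?P \<Otimes>\<^sub>M ?Q)"
      using Fm gm by (simp add: split_beta')
    then show ?thesis unfolding \<Psi>_def by (rule Q.borel_measurable_nn_integral)
  qed
  have [measurable]: "?f \<in> borel_measurable ?P" by measurable
  have g_zero: "?g (?merge x c) = 0" if "?f x = 0" for x c
  proof (rule ccontr)
    assume nz: "?g (?merge x c) \<noteq> 0"
    interpret bordered "corr_mat K x" b "\<chi> i. if i \<in> K then c (i, b) else 0"
      by (rule bordered_corr_mat[OF b])
    from nz have "pos_semidef (corr_mat K x)" "det (corr_mat K x) \<noteq> 0"
      using pos_def_border_imp corr_density_nz_iff[OF m(1,3), of "corr_mat (insert b K) (?merge x c)"]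
      by (auto simp: corr_mat_merge[OF b] psd_unit_diag_def)
    with that corr_density_nz_iff[OF m(2,3)] show False
      by (metis corr_mat_in_psd_unit_diag_iff)
  qed
  \<comment> \<open>The induction hypothesis itself shows that the old vectors are almost surely linearly
    independent: under a density, the set where the density vanishes is a null set.\<close>
  have AE_nz: "AE v in \<Pi>\<^sub>M i\<in>K. ?S. ?f (inner_pairs K v) \<noteq> 0"
  proof -
    have "(\<integral>\<^sup>+ v. indicator {0} (?f (inner_pairs K v)) \<partial>(\<Pi>\<^sub>M i\<in>K. ?S)) = (\<integral>\<^sup>+ x. ?f x * indicator {0} (?f x) \<partial>?P)"
      by (rule insert.IH) measurable
    also have "\<dots> = (\<integral>\<^sup>+ x. 0 \<partial>?P)"
      by (intro nn_integral_cong) (auto split: split_indicator)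
    finally have "(\<integral>\<^sup>+ v. indicator {0} (?f (inner_pairs K v)) \<partial>(\<Pi>\<^sub>M i\<in>K. ?S)) = 0" by simp
    then have "AE v in \<Pi>\<^sub>M i\<in>K. ?S. indicator {0} (?f (inner_pairs K v)) = (0::ennreal)"
      by (subst (asm) nn_integral_0_iff_AE) measurable
    then show ?thesis by eventually_elim (auto simp: indicator_def)
  qed
  have "(\<integral>\<^sup>+ v. F (inner_pairs (insert b K) v) \<partial>(\<Pi>\<^sub>M i\<in>insert b K. ?S)) =
      (\<integral>\<^sup>+ v. (\<integral>\<^sup>+ w. F (inner_pairs (insert b K) (v(b := w))) \<partial>?S) \<partial>(\<Pi>\<^sub>M i\<in>K. ?S))"
    using insert.hyps(1) bK
    by (intro S.product_nn_integral_insert measurable_compose[OF inner_pairs_measurable F])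
  also have "\<dots> = (\<integral>\<^sup>+ v. \<Psi> (inner_pairs K v) / ?f (inner_pairs K v) \<partial>(\<Pi>\<^sub>M i\<in>K. ?S))"
  proof (rule nn_integral_cong_AE)
    show "AE v in \<Pi>\<^sub>M i\<in>K. ?S. (\<integral>\<^sup>+ w. F (inner_pairs (insert b K) (v(b := w))) \<partial>?S) =
        \<Psi> (inner_pairs K v) / ?f (inner_pairs K v)"
      using AE_nz AE_space
    proof eventually_elim
      case (elim v)
      define x where "x = inner_pairs K v"
      have "x \<in> space ?P"
        using measurable_space[OF inner_pairs_measurable elim(2)] by (simp add: x_def)
      from measurable_compose[OF measurable_Pair1'[OF this] Fm]
      have H: "(\<lambda>c. F (?merge x c)) \<in> borel_measurable ?Q" .
      have norm: "norm (v i) = 1" if "i \<in> K" for i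
        using elim(2) that by (auto simp: space_PiM PiE_def Pi_def)
      have "(\<integral>\<^sup>+ w. F (?merge x (\<lambda>p\<in>?J. v (fst p) \<bullet> w)) \<partial>?S) * ?f x = \<Psi> x"
        using conditional_inner_products[OF le b norm x_def _ H] elim(1)
        by (simp add: x_def \<Psi>_def n_def corr_mat_merge[OF b] border_vec_def)
      then show ?case
        using elim(1) corr_density_finite[of n "card K" "corr_mat K x"]
        by (simp add: inner_pairs_insert[OF b] x_def[symmetric])
           (metis mult_divide_eq_ennreal)
    qed
  qed
  also have "\<dots> = (\<integral>\<^sup>+ x. ?f x * (\<Psi> x / ?f x) \<partial>?P)"
    by (rule insert.IH) measurable
  also have "\<dots> = (\<integral>\<^sup>+ x. \<Psi> x \<partial>?P)"
  proof (rule nn_integral_cong)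
    fix x
    show "?f x * (\<Psi> x / ?f x) = \<Psi> x"
    proof (cases "?f x = 0")
      case True
      then have "\<Psi> x = 0" unfolding \<Psi>_def by (simp add: g_zero)
      then show ?thesis by simp
    next
      case False
      then show ?thesis
        using corr_density_finite[of n "card K" "corr_mat K x"]
        by (metis ennreal_times_divide mult.commute mult_divide_eq_ennreal)
    qed
  qed
  also have "\<dots> = (\<integral>\<^sup>+ x. ?g x * F x \<partial>(\<Pi>\<^sub>M p\<in>pairs (insert b K). lborel))"
  proof -
    have "(\<lambda>x. ?g x * F x) \<in> borel_measurable (\<Pi>\<^sub>M p\<in>pairs (insert b K). lborel)" by measurable
    then have gF: "(\<lambda>x. ?g x * F x) \<in> borel_measurable (\<Pi>\<^sub>M p\<in>pairs K \<union> ?J. lborel)"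
      by (simp only: pairs_insert(1)[OF b])
    have finJ: "finite ?J" by simp
    show ?thesis
      unfolding \<Psi>_def pairs_insert(1)[OF b]
      by (rule lborel_prod.product_nn_integral_fold[OF pairs_insert(2)[OF b] finite_pairs finJ gF, symmetric])
  qed
  finally show ?case by (simp only: card)
qed

theorem theorem2p1:
  fixes P :: "'a measure"
    and v :: "'k::{finite,wellorder} \<Rightarrow> 'a \<Rightarrow> real^'n::{finite,wellorder}"
  assumes "prob_space P"
    and "2 \<le> CARD('k)"
    and "CARD('k) \<le> CARD('n)"
    and "prob_space.indep_vars P (\<lambda>_. uniform_sphere) v UNIV"
    and "\<And>i. distr P uniform_sphere (v i) = uniform_sphere"
  shows "distributed P lborel_sym_unit_diag (\<lambda>\<omega>. Gram_matrix (\<lambda>i. v i \<omega>))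
           (\<lambda>A. if A \<in> psd_unit_diag
                then ennreal (det A powr ((real CARD('n) - real CARD('k) - 1) / 2)
                              * Gamma (real CARD('n) / 2) ^ CARD('k)
                              * inverse (multivariate_Gamma CARD('k) (real CARD('n) / 2)))
                else 0)"
proof -
  interpret prob_space P by fact
  let ?S = "uniform_sphere :: (real^'n::_) measure"
  let ?V = "\<lambda>\<omega>. \<lambda>i\<in>UNIV. v i \<omega>"
  let ?L = "\<Pi>\<^sub>M p\<in>(above_diag :: ('k \<times> 'k) set). lborel :: real measure"
  let ?N = "lborel_sym_unit_diag :: (real^'k::_^'k::_) measure"
  let ?f = "corr_density (real CARD('n)) CARD('k) :: real^'k::_^'k::_ \<Rightarrow> ennreal"
  have rv: "v i \<in> measurable P ?S" for i
    using assms(4) by (auto simp: indep_vars_def)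
  have V: "?V \<in> measurable P (\<Pi>\<^sub>M i\<in>UNIV. ?S)"
    using rv by (intro measurable_restrict)
  have joint: "distr P (\<Pi>\<^sub>M i\<in>UNIV. ?S) ?V = (\<Pi>\<^sub>M i\<in>UNIV. ?S)"
    using indep_vars_iff_distr_eq_PiM[of UNIV v "\<lambda>_. ?S"] rv assms(4,5) by simp
  have above: "pairs UNIV = (above_diag :: ('k \<times> 'k) set)"
    by (auto simp: pairs_def above_diag_def)
  have mat: "corr_mat UNIV x = (matrix_of_above_diag x :: real^'k::_^'k::_)" for x
    by (auto simp: vec_eq_iff corr_mat_nth matrix_of_above_diag_def)
  have ip: "inner_pairs UNIV \<in> measurable (\<Pi>\<^sub>M i\<in>UNIV. ?S) ?L"
    using inner_pairs_measurable[of "UNIV :: 'k set"] by (simp add: above)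
  have fN: "?f \<in> borel_measurable ?N"
    unfolding lborel_sym_unit_diag_def by (auto intro: measurable_restrict_space1)
  have "?f \<in> borel_measurable (restrict_space borel sym_unit_diag)"
    by (auto intro: measurable_restrict_space1)
  have fL: "(\<lambda>x. ?f (matrix_of_above_diag x)) \<in> borel_measurable ?L"
    by (rule measurable_compose[OF matrix_of_above_diag_measurable]) fact
  have pairs_law: "distr (\<Pi>\<^sub>M i\<in>UNIV. ?S) ?L (inner_pairs UNIV) = density ?L (\<lambda>x. ?f (matrix_of_above_diag x))"
  proof (rule measure_eqI)
    fix X assume "X \<in> sets (distr (\<Pi>\<^sub>M i\<in>UNIV. ?S) ?L (inner_pairs UNIV))"
    then have X: "X \<in> sets ?L" by simp
    then have "emeasure (distr (\<Pi>\<^sub>M i\<in>UNIV. ?S) ?L (inner_pairs UNIV)) X =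
        (\<integral>\<^sup>+ u. indicator X (inner_pairs UNIV u) \<partial>(\<Pi>\<^sub>M i\<in>UNIV. ?S))"
    proof -
      have "emeasure (distr (\<Pi>\<^sub>M i\<in>UNIV. ?S) ?L (inner_pairs UNIV)) X =
          (\<integral>\<^sup>+ x. indicator X x \<partial>distr (\<Pi>\<^sub>M i\<in>UNIV. ?S) ?L (inner_pairs UNIV))"
        by (rule nn_integral_indicator[symmetric]) (simp add: X)
      also have "\<dots> = (\<integral>\<^sup>+ u. indicator X (inner_pairs UNIV u) \<partial>(\<Pi>\<^sub>M i\<in>UNIV. ?S))"
        by (rule nn_integral_distr[OF ip], rule borel_measurable_indicator) (simp add: X)
      finally show ?thesis .
    qed
    also have "\<dots> = (\<integral>\<^sup>+ x. ?f (matrix_of_above_diag x) * indicator X x \<partial>?L)"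
      using nn_integral_inner_pairs[OF assms(3), of "indicator X" UNIV] borel_measurable_indicator[OF X]
      by (simp add: above mat)
    also have "\<dots> = emeasure (density ?L (\<lambda>x. ?f (matrix_of_above_diag x))) X"
      using X fL by (subst emeasure_density) auto
    finally show "emeasure (distr (\<Pi>\<^sub>M i\<in>UNIV. ?S) ?L (inner_pairs UNIV)) X =
        emeasure (density ?L (\<lambda>x. ?f (matrix_of_above_diag x))) X" .
  qed simp
  have mN: "matrix_of_above_diag \<in> measurable ?L ?N"
    using matrix_of_above_diag_measurable unfolding lborel_sym_unit_diag_def by simp
  have Gram: "Gram_matrix (\<lambda>i. v i \<omega>) = matrix_of_above_diag (inner_pairs UNIV (?V \<omega>))" if "\<omega> \<in> space P" for \<omega>
  proof -
    have norm: "norm (v i \<omega>) = 1" for i using measurable_space[OF rv that, of i] by simp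
    have "v i \<omega> \<bullet> v j \<omega> = matrix_of_above_diag (inner_pairs UNIV (?V \<omega>)) $ i $ j" for i j
    proof (cases i j rule: linorder_cases)
      case less
      then show ?thesis by (simp add: matrix_of_above_diag_def inner_pairs_def pairs_def)
    next
      case equal
      then show ?thesis using norm[of j] by (simp add: matrix_of_above_diag_def norm_eq_1)
    next
      case greater
      then have "\<not> i < j" "i \<noteq> j" by auto
      with greater show ?thesis
        by (simp add: matrix_of_above_diag_def inner_pairs_def pairs_def inner_commute[of "v j \<omega>"])
    qed
    then show ?thesis by (simp add: vec_eq_iff Gram_matrix_def)
  qed
  have X: "(\<lambda>\<omega>. matrix_of_above_diag (inner_pairs UNIV (?V \<omega>))) \<in> measurable P ?N"
    by (rule measurable_compose[OF V measurable_compose[OF ip mN]])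
  have "distr P ?N (\<lambda>\<omega>. Gram_matrix (\<lambda>i. v i \<omega>)) = distr P ?N (\<lambda>\<omega>. matrix_of_above_diag (inner_pairs UNIV (?V \<omega>)))"
    by (rule distr_cong) (simp_all add: Gram)
  also have "\<dots> = distr (distr (distr P (\<Pi>\<^sub>M i\<in>UNIV. ?S) ?V) ?L (inner_pairs UNIV)) ?N matrix_of_above_diag"
    using V ip mN by (simp add: distr_distr measurable_comp[OF V ip] o_def)
  also have "\<dots> = distr (density ?L (\<lambda>x. ?f (matrix_of_above_diag x))) ?N matrix_of_above_diag"
    by (simp add: joint pairs_law)
  also have "\<dots> = density (distr ?L ?N matrix_of_above_diag) ?f"
    using fN mN by (rule density_distr[symmetric])
  also have "distr ?L ?N matrix_of_above_diag = ?N"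
    by (simp add: lborel_sym_unit_diag_def cong: distr_cong)
  finally have "distr P ?N (\<lambda>\<omega>. Gram_matrix (\<lambda>i. v i \<omega>)) = density ?N ?f" .
  moreover have "(\<lambda>\<omega>. Gram_matrix (\<lambda>i. v i \<omega>)) \<in> measurable P ?N"
    using X by (subst measurable_cong[OF Gram])
  ultimately have "distributed P ?N (\<lambda>\<omega>. Gram_matrix (\<lambda>i. v i \<omega>)) ?f"
    using fN by (simp add: distributed_def)
  then show ?thesis by (simp add: corr_density_def[abs_def])
qed

end
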